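(* Let $d\ge 1$ and let $P_1,\dots,P_n$ ($n\ge 1$) be zones of positive width on the unit $d$-sphere $S^d\subset\mathbb{R}^{d+1}$ which cover $S^d$, i.e. $S^d=\bigcup_{i=1}^n P_i$. For each $i\in\{1,\dots,n\}$ let $2\alpha_i$ be the width of $P_i$, and let $\ell_i$ be the line through the origin perpendicular to the central hyperplane of $P_i$. Then the total width satisfies \[ \sum_{i=1}^n 2\alpha_i\ \ge\ \pi . \] Moreover, equality $\sum_{i=1}^n 2\alpha_i=\pi$ holds if and only if, after reordering the zones, $\ell_1,\dots,\ell_n$ are coplanar lines in clockwise order such that the angle between $\ell_i$ and $\ell_{i+1}$ equals $\alpha_i+\alpha_{i+1}$ for all $i\in\{1,\dots,n\}$, under the convention that $\ell_{n+1}=\ell_1$ and $\alpha_{n+1}=\alpha_1$.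
   Context: $S^d$ is the unit sphere in $\mathbb{R}^{d+1}$ centered at the origin; the spherical distance between two points is the angle between them as unit vectors. A great sphere is the intersection of $S^d$ with a hyperplane passing through the origin. Given a great sphere $C$, the zone of width $\omega$ determined by $C$ is the set of points of $S^d$ within spherical distance $\omega/2$ (that is, at distance at most $\omega/2$) of $C$; its central hyperplane is the hyperplane through the origin containing $C$ by which $C$ is cut out. "Coplanar lines" means that all the lines lie in a common $2$-dimensional linear subspace. "In clockwise order" means that, for an orientation of that plane, rotating clockwise about the origin from $\ell_1$ through total angle $\pi$ (back to $\ell_1$) one meets $\ell_1,\ell_2,\dots,\ell_n$ in this order; the angle between $\ell_i$ and $\ell_{i+1}$ is the angle of the clockwise rotation from $\ell_i$ to the next line $\ell_{i+1}$ (for $n=1$ this is the rotation by $\pi$ from $\ell_1$ back to itself). *)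

theory Defs
  imports "HOL-Analysis.Analysis" "HOL-Combinatorics.Permutations"
begin

definition linear_hyperplane :: "'a::euclidean_space set \<Rightarrow> bool" where
  "linear_hyperplane H \<longleftrightarrow> (\<exists>u. u \<noteq> 0 \<and> H = {x. u \<bullet> x = 0})"

definition great_sphere :: "'a::euclidean_space set \<Rightarrow> 'a set" where
  "great_sphere H = sphere 0 1 \<inter> H"

text \<open>The angle between two unit vectors; only meaningful for points of the unit sphere.\<close>

definition spherical_dist :: "'a::euclidean_space \<Rightarrow> 'a \<Rightarrow> real" where
  "spherical_dist x y = arccos (x \<bullet> y)"

text \<open>In ambient dimension at least 2 a great sphere is nonempty, so the infimum below is a
  genuine one whenever C is a great sphere.\<close>

definition spherical_infdist :: "'a::euclidean_space \<Rightarrow> 'a set \<Rightarrow> real" where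
  "spherical_infdist x C = (INF y\<in>C. spherical_dist x y)"

definition zone :: "'a::euclidean_space set \<Rightarrow> real \<Rightarrow> 'a set" where
  "zone C w = {x \<in> sphere 0 1. spherical_infdist x C \<le> w / 2}"

text \<open>An orientation of a plane V is given by an orthonormal basis (u, v) of V, where the
  quarter turn taking u to v is taken to be counterclockwise.\<close>

definition orthonormal_frame :: "'a::euclidean_space set \<Rightarrow> 'a \<Rightarrow> 'a \<Rightarrow> bool" where
  "orthonormal_frame V u v \<longleftrightarrow>
     norm u = 1 \<and> norm v = 1 \<and> orthogonal u v \<and> span {u, v} = V"

text \<open>Clockwise rotation by the angle t in the plane oriented by (u, v): it takes u to
  cos t u - sin t v, and v to sin t u + cos t v. Vectors outside the plane are first projected
  to it; it is applied only to subsets of the plane.\<close>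

definition clockwise_rotation :: "'a::euclidean_space \<Rightarrow> 'a \<Rightarrow> real \<Rightarrow> 'a \<Rightarrow> 'a" where
  "clockwise_rotation u v t x =
     (x \<bullet> u) *\<^sub>R (cos t *\<^sub>R u - sin t *\<^sub>R v) + (x \<bullet> v) *\<^sub>R (sin t *\<^sub>R u + cos t *\<^sub>R v)"

text \<open>The number t i is the angle at which the line l i is met when rotating clockwise
  from l 1 through the total angle pi.\<close>

definition in_clockwise_order ::
    "'a::euclidean_space \<Rightarrow> 'a \<Rightarrow> nat \<Rightarrow> (nat \<Rightarrow> 'a set) \<Rightarrow> bool" where
  "in_clockwise_order u v n l \<longleftrightarrow>
     (\<exists>t::nat \<Rightarrow> real. t 1 = 0 \<and> strict_mono_on {1..n} t \<and> t n < pi \<and>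
        (\<forall>i\<in>{1..n}. l i = clockwise_rotation u v (t i) ` l 1))"

text \<open>For lines l and m through the origin in the plane spanned by u and v, exactly one t with
  0 < t \<le> pi has the required property; for l = m it is pi.\<close>

definition clockwise_angle ::
    "'a::euclidean_space \<Rightarrow> 'a \<Rightarrow> 'a set \<Rightarrow> 'a set \<Rightarrow> real" where
  "clockwise_angle u v l m = (THE t. 0 < t \<and> t \<le> pi \<and> clockwise_rotation u v t ` l = m)"

end

theory Submission
  imports Defs "HOL-Real_Asymp.Real_Asymp"
begin

text \<open>Let a point at latitude \<open>\<phi>\<close> relative to the \<open>k\<close>-th central hyperplane have potential
  \<open>\<integral> ln \<bar>sin (\<phi> - t)\<bar> dt\<close> over \<open>\<bar>t\<bar> \<le> \<alpha> k\<close>, and let \<open>x\<close> maximise the sum \<open>U\<close> of these potentials over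
  the sphere. Parametrise a great circle through \<open>x\<close>, with \<open>e\<close> a unit tangent at \<open>x\<close>, by the point
  \<open>p u\<close> proportional to \<open>u x + e\<close>, and integrate \<open>U (p u) - U x\<close> over the line. For fixed \<open>t\<close> the
  integrand is \<open>ln\<close> of a monic quadratic over \<open>1 + u\<^sup>2\<close>, and each of its two roots \<open>r\<close>, real or not,
  contributes at least \<open>\<integral> (ln \<bar>u - r\<bar> - ln (1 + u\<^sup>2) / 2) du = - \<pi>\<close>; so zone \<open>k\<close> contributes at
  least \<open>- 2 \<pi> (\<alpha> k)\<close>. If \<open>x\<close> is interior to zone \<open>i\<close> and the circle passes through its pole, then,
  since the potential of a zone of half width \<open>\<pi>/2\<close> is constant, zone \<open>i\<close> contributes
  \<open>\<pi>\<^sup>2 - 2 \<pi> (\<alpha> i)\<close>. The total is nonpositive by maximality, which gives \<open>\<Sum> 2 (\<alpha> k) \<ge> \<pi>\<close>.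

  In the equality case the integral vanishes, so the whole circle consists of maxima, and a maximum
  cannot be interior to two zones because of the additional contribution of an overlap. Hence on a
  great circle of maxima the zones cut out nonoverlapping arcs, of length at least \<open>2 (\<alpha> k)\<close> each and
  larger than that when the pole of the zone is not on the circle. As the lengths add up to at most
  \<open>\<pi>\<close>, all poles lie on the circle and consecutive arcs abut.\<close>

section \<open>Logarithmic integrals\<close>

text \<open>On the reals \<open>ln (- x) = ln x\<close> and \<open>ln 0 = 0\<close>, so \<open>ln\<close> serves as \<open>ln \<bar>x\<bar>\<close> throughout, up to
  finitely many exceptional points under an integral.\<close>

lemma ln_abs_real: "ln \<bar>x::real\<bar> = ln x"
  by (simp add: abs_if ln_minus)

lemma DERIV_ln_nonzero:
  fixes x :: real
  assumes "x \<noteq> 0"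
  shows "(ln has_real_derivative 1 / x) (at x)"
proof (cases "x > 0")
  case False
  with assms have "((\<lambda>t. ln (- t)) has_real_derivative 1 / x) (at x)"
    by (auto intro!: derivative_eq_intros)
  then show ?thesis by (simp add: ln_minus)
qed (auto intro: DERIV_ln_divide)

text \<open>Makes the primitive \<open>x * ln x - x\<close> of \<open>ln\<close> continuous across
  the singularity at 0, so that the fundamental theorem of calculus with one exceptional point
  covers intervals containing 0.\<close>

lemma continuous_on_mult_ln: "continuous_on UNIV (\<lambda>x::real. x * ln x)"
proof -
  have "isCont (\<lambda>x::real. x * ln x) x" for x
  proof (cases "x = 0")
    case True
    have "((\<lambda>x::real. x * ln x) \<longlongrightarrow> 0) (at_right 0)"
      by real_asymp
    moreover have "((\<lambda>x::real. x * ln x) \<longlongrightarrow> 0) (at_left 0)"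
    proof -
      have "((\<lambda>x::real. - (x * ln x)) \<longlongrightarrow> 0) (at_right 0)"
        by real_asymp
      then show ?thesis
        by (simp add: filterlim_at_left_to_right ln_minus)
    qed
    ultimately have "((\<lambda>x::real. x * ln x) \<longlongrightarrow> 0) (at 0)"
      by (simp add: filterlim_at_split)
    then show ?thesis using True by (simp add: isCont_def)
  next
    case False
    then show ?thesis by (intro continuous_intros) auto
  qed
  then show ?thesis by (simp add: continuous_at_imp_continuous_on)
qed

lemma has_integral_ln_shift:
  fixes a b r :: real
  assumes "a \<le> b"
  shows "((\<lambda>u. ln (u - r)) has_integral
    ((b - r) * ln (b - r) - (a - r) * ln (a - r) - (b - a))) {a..b}"
proof -
  have "((\<lambda>u. ln (u - r)) has_integral
     ((b - r) * ln (b - r) - b) - ((a - r) * ln (a - r) - a)) {a..b}"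
  proof (rule fundamental_theorem_of_calculus_strong[where S = "{r}"])
    show "continuous_on {a..b} (\<lambda>u. (u - r) * ln (u - r) - u)"
      by (intro continuous_intros
          continuous_on_compose2[OF continuous_on_mult_ln, where f = "\<lambda>u. u - r"]) auto
    show "((\<lambda>u. (u - r) * ln (u - r) - u) has_vector_derivative ln (x - r)) (at x)"
      if "x \<in> {a..b} - {r}" for x
    proof -
      have d: "((\<lambda>u. u - r) has_real_derivative 1) (at x)"
        by (auto intro!: derivative_eq_intros)
      have D: "((\<lambda>u. ln (u - r)) has_real_derivative 1 / (x - r) * 1) (at x)"
        using that by (intro DERIV_chain2[OF DERIV_ln_nonzero d]) auto
      have "((\<lambda>u. (u - r) * ln (u - r) - u) has_real_derivative ln (x - r)) (at x)"
        using DERIV_diff[OF DERIV_mult[OF d D] DERIV_ident] that by simp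
      then show ?thesis
        by (simp add: has_real_derivative_iff_has_vector_derivative)
    qed
  qed (use assms in auto)
  then show ?thesis by (simp add: algebra_simps)
qed

lemma has_integral_ln_one_plus_square:
  fixes R :: real
  assumes "0 \<le> R"
  shows "((\<lambda>u. ln (1 + u\<^sup>2)) has_integral
    (2 * R * ln (1 + R\<^sup>2) - 4 * R + 4 * arctan R)) {-R..R}"
proof -
  have "((\<lambda>u. ln (1 + u\<^sup>2)) has_integral
     (R * ln (1 + R\<^sup>2) - 2 * R + 2 * arctan R)
       - (-R * ln (1 + (-R)\<^sup>2) - 2 * (-R) + 2 * arctan (-R))) {-R..R}"
  proof (rule fundamental_theorem_of_calculus)
    fix x :: real
    have pos: "1 + x\<^sup>2 > 0" by (simp add: add_pos_nonneg)
    have "((\<lambda>u. u * ln (1 + u\<^sup>2) - 2 * u + 2 * arctan u) has_real_derivative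
        ln (1 + x\<^sup>2) + x * (2 * x / (1 + x\<^sup>2)) - 2 + 2 * (1 / (1 + x\<^sup>2))) (at x)"
      using pos by (auto intro!: derivative_eq_intros simp: divide_inverse)
    moreover have "x * (2 * x / (1 + x\<^sup>2)) + 2 * (1 / (1 + x\<^sup>2)) = 2"
    proof -
      have "x * (2 * x / (1 + x\<^sup>2)) + 2 * (1 / (1 + x\<^sup>2)) = (x * (2 * x) + 2) / (1 + x\<^sup>2)"
        by (simp add: add_divide_distrib)
      also have "x * (2 * x) + 2 = 2 * (1 + x\<^sup>2)"
        by (simp add: power2_eq_square algebra_simps)
      finally show ?thesis using pos by (metis nonzero_mult_div_cancel_right less_irrefl)
    qed
    ultimately have "((\<lambda>u. u * ln (1 + u\<^sup>2) - 2 * u + 2 * arctan u) has_real_derivative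
        ln (1 + x\<^sup>2)) (at x)"
      by (simp add: algebra_simps)
    then show "((\<lambda>u. u * ln (1 + u\<^sup>2) - 2 * u + 2 * arctan u) has_vector_derivative ln (1 + x\<^sup>2)) (at x within {-R..R})"
      by (simp add: has_real_derivative_iff_has_vector_derivative has_vector_derivative_at_within)
  qed (use assms in auto)
  then show ?thesis by (simp add: arctan_minus algebra_simps)
qed

lemma integrable_ln_cmod: "(\<lambda>u. ln (cmod (of_real u - r))) integrable_on {a..b}"
proof (cases "Im r = 0")
  case True
  have "ln (cmod (of_real u - r)) = ln (u - Re r)" for u
  proof -
    have "of_real u - r = of_real (u - Re r)" using True by (simp add: complex_eq_iff)
    then have "cmod (of_real u - r) = \<bar>u - Re r\<bar>" by (metis norm_of_real)
    then show ?thesis by (simp only: ln_abs_real)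
  qed
  then show ?thesis
    using has_integral_ln_shift[of a b "Re r"] by (cases "a \<le> b") auto
next
  case False
  then have "of_real u \<noteq> r" for u by auto
  then show ?thesis
    by (intro integrable_continuous_interval continuous_intros) auto
qed

text \<open>The right side is the tangent at \<open>R\<close> of the convex function
  \<open>x * ln x\<close>; the end point \<open>x = 0\<close> is included because the function
  vanishes there.\<close>

lemma mult_ln_ge_tangent:
  fixes x R :: real
  assumes "0 \<le> x" "0 < R"
  shows "x * ln x \<ge> x * ln R + (x - R)"
proof (cases "x = 0")
  case False
  with assms have x: "x > 0" by simp
  have "ln (R / x) \<le> R / x - 1" using x assms by (intro ln_le_minus_one) simp
  then have "ln R - ln x \<le> R / x - 1" using x assms by (simp add: ln_div)
  then have "x * (ln R - ln x) \<le> x * (R / x - 1)" using x by (intro mult_left_mono) auto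
  then show ?thesis using x by (simp add: algebra_simps)
qed (use assms in auto)

text \<open>Moving \<open>r\<close> to the nearest point of the interval only decreases
  \<open>cmod (of_real u - r)\<close>; for a real point of the interval the integral is explicit,
  and by convexity of \<open>x * ln x\<close> it is smallest for the midpoint 0.\<close>

lemma integral_ln_cmod_ge:
  assumes "0 < R"
  shows "integral {-R..R} (\<lambda>u. ln (cmod (of_real u - r))) \<ge> 2 * R * ln R - 2 * R"
proof -
  \<comment> \<open>The point of \<open>{-R..R}\<close> nearest to \<open>Re r\<close>.\<close>
  define p where "p = max (-R) (min R (Re r))"
  have p: "-R \<le> p" "p \<le> R" using assms by (auto simp: p_def)
  have i: "((\<lambda>u. ln (u - p)) has_integral ((R - p) * ln (R - p) + (R + p) * ln (R + p) - 2 * R)) {-R..R}"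
    using has_integral_ln_shift[of "-R" R p] assms ln_minus[of "R + p"]
    by (simp add: algebra_simps)
  \<comment> \<open>At \<open>u = p\<close> the convention \<open>ln 0 = 0\<close> could break the
    pointwise comparison, so the minorant is altered at that single point.\<close>
  let ?g = "\<lambda>u. if u = p then ln (cmod (of_real u - r)) else ln (u - p)"
  have g: "(?g has_integral ((R - p) * ln (R - p) + (R + p) * ln (R + p) - 2 * R)) {-R..R}"
    by (rule has_integral_spike_finite[OF _ _ i, of "{p}"]) auto
  have "?g u \<le> ln (cmod (of_real u - r))" if u: "u \<in> {-R..R}" for u
  proof (cases "u = p")
    case False
    have "\<bar>u - p\<bar> \<le> \<bar>u - Re r\<bar>" using u by (auto simp: p_def)
    also have "\<dots> \<le> cmod (of_real u - r)" using abs_Re_le_cmod[of "of_real u - r"] by simp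
    finally have "ln \<bar>u - p\<bar> \<le> ln (cmod (of_real u - r))" using False by (intro ln_mono) auto
    moreover have "ln \<bar>u - p\<bar> = ln (u - p)" by (simp add: ln_abs_real)
    ultimately show ?thesis using False by simp
  qed simp
  then have "(R - p) * ln (R - p) + (R + p) * ln (R + p) - 2 * R
      \<le> integral {-R..R} (\<lambda>u. ln (cmod (of_real u - r)))"
    using has_integral_le[OF g integrable_integral[OF integrable_ln_cmod]] by blast
  moreover have "(R - p) * ln (R - p) \<ge> (R - p) * ln R + (R - p - R)"
    using p assms by (intro mult_ln_ge_tangent) auto
  moreover have "(R + p) * ln (R + p) \<ge> (R + p) * ln R + (R + p - R)"
    using p assms by (intro mult_ln_ge_tangent) auto
  ultimately show ?thesis by (simp add: algebra_simps)
qed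

text \<open>A root this far away stays at distance at least \<open>R\<close> from the whole
  interval. The gain of \<open>2 * R\<close> over the general bound is what later penalises
  overlapping zones.\<close>

lemma integral_ln_cmod_ge_of_large:
  assumes "0 < R" "2 * R \<le> cmod r"
  shows "integral {-R..R} (\<lambda>u. ln (cmod (of_real u - r))) \<ge> 2 * R * ln R"
proof -
  have "((\<lambda>u. ln R) has_integral (2 * R * ln R)) {-R..R}"
    using has_integral_const_real[of "ln R" "-R" R] assms by simp
  moreover have "ln R \<le> ln (cmod (of_real u - r))" if "u \<in> {-R..R}" for u
  proof -
    have "cmod r \<le> cmod (of_real u - r) + \<bar>u\<bar>"
      using norm_triangle_ineq4[of "of_real u" "of_real u - r"] by simp
    with that assms have "R \<le> cmod (of_real u - r)" by auto
    then show ?thesis using assms by (intro ln_mono) auto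
  qed
  ultimately show ?thesis
    using has_integral_le[OF _ integrable_integral[OF integrable_ln_cmod]] by blast
qed

text \<open>Upper counterpart for a real root, from \<open>ln (1 + s / R) \<le> s / R\<close> at
  both ends of the interval; the error term vanishes as \<open>R\<close> grows.\<close>

lemma integral_ln_real_le:
  fixes r R :: real
  assumes "\<bar>r\<bar> < R"
  shows "integral {-R..R} (\<lambda>u. ln (u - r)) \<le> 2 * R * ln R - 2 * R + 2 * r\<^sup>2 / R"
proof -
  have R: "0 < R" using assms by linarith
  have *: "(R + s) * ln (R + s) \<le> (R + s) * ln R + (R + s) * (s / R)" if "\<bar>s\<bar> < R" for s
  proof -
    have "ln ((R + s) / R) \<le> (R + s) / R - 1" using that R by (intro ln_le_minus_one) auto
    moreover have "ln ((R + s) / R) = ln (R + s) - ln R" using that R by (simp add: ln_div)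
    moreover have "(R + s) / R - 1 = s / R" using R by (simp add: field_simps)
    ultimately have "ln (R + s) \<le> ln R + s / R" by linarith
    then have "(R + s) * ln (R + s) \<le> (R + s) * (ln R + s / R)" using that by (intro mult_left_mono) auto
    then show ?thesis by (simp add: algebra_simps)
  qed
  have "integral {-R..R} (\<lambda>u. ln (u - r)) = (R - r) * ln (R - r) + (R + r) * ln (R + r) - 2 * R"
    using integral_unique[OF has_integral_ln_shift[of "-R" R r]] R ln_minus[of "R + r"]
    by (simp add: algebra_simps)
  also have "\<dots> \<le> ((R + -r) * ln R + (R + -r) * (-r / R)) + ((R + r) * ln R + (R + r) * (r / R)) - 2 * R"
    using *[of r] *[of "-r"] assms by simp
  also have "\<dots> = 2 * R * ln R - 2 * R + 2 * r\<^sup>2 / R"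
    using R by (simp add: field_simps power2_eq_square)
  finally show ?thesis .
qed

text \<open>A crude form of Jordan's inequality, used to dominate \<open>ln (sin x)\<close> near 0.
  Up to \<open>pi / 3\<close> the derivative of the sine is at least 1/2; beyond that, the sine is
  at least 4/5 and \<open>x / 2\<close> at most 4/5.\<close>

lemma half_le_sin:
  fixes x :: real
  assumes "0 \<le> x" "x \<le> pi / 2"
  shows "x / 2 \<le> sin x"
proof -
  have *: "x / 2 \<le> sin x" if "0 \<le> x" "x \<le> pi / 3" for x
  proof -
    have "0 / 2 - sin 0 \<ge> x / 2 - sin x"
    proof (rule DERIV_nonpos_imp_nonincreasing[where f = "\<lambda>x. x / 2 - sin x"])
      fix t assume t: "0 \<le> t" "t \<le> x"
      have "cos t \<ge> cos (pi / 3)" using t that by (intro cos_monotone_0_pi_le) auto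
      then have "cos t \<ge> 1 / 2" by (simp add: cos_60)
      moreover have "((\<lambda>x. x / 2 - sin x) has_real_derivative (1 / 2 - cos t)) (at t)"
        by (auto intro!: derivative_eq_intros)
      ultimately show "\<exists>y. ((\<lambda>x. x / 2 - sin x) has_real_derivative y) (at t) \<and> y \<le> 0"
        by (intro exI[of _ "1/2 - cos t"]) auto
    qed (use that in auto)
    then show ?thesis by simp
  qed
  show ?thesis
  proof (cases "x \<le> pi / 3")
    case False
    then have "sin (pi / 3) \<le> sin x" using assms by (intro sin_monotone_2pi_le) auto
    moreover have "sqrt 3 \<ge> 8 / 5" by (rule real_le_rsqrt) (simp add: power2_eq_square)
    moreover have "x / 2 \<le> 4 / 5" using assms pi_less_4 pi_approx by auto
    ultimately show ?thesis by (simp add: sin_60)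
  qed (use * assms in auto)
qed

text \<open>Around 0 the function is dominated by a logarithm. A translation by \<open>pi\<close>
  only changes the sign of the sine, which \<open>ln\<close> ignores, so integrability spreads to
  intervals growing by \<open>pi\<close> on either side.\<close>

lemma ln_sin_integrable: "(\<lambda>x::real. ln (sin x)) integrable_on {a..b}"
proof -
  have base: "(\<lambda>x::real. ln (sin x)) integrable_on {-(pi/2)..pi/2}"
  proof (rule measurable_bounded_by_integrable_imp_integrable_real)
    show "(\<lambda>x::real. ln (sin x)) \<in> borel_measurable (lebesgue_on {-(pi/2)..pi/2})"
    proof -
      have "(\<lambda>x::real. ln (sin x)) \<in> borel_measurable borel"
        by (intro borel_measurable_ln borel_measurable_continuous_onI continuous_intros)
      then show ?thesis
        by (intro measurable_restrict_space1 measurable_completion) simp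
    qed
    \<comment> \<open>The dominating function comes from \<bar>x\<bar> / 2 \<le> sin \<bar>x\<bar>;
      at \<open>x = 0\<close> both logarithms take their default value 0.\<close>
    show "(\<lambda>x::real. ln 2 - ln (x - 0)) integrable_on {-(pi/2)..pi/2}"
      using has_integral_ln_shift[of "-(pi/2)" "pi/2" 0]
      by (intro integrable_diff integrable_const_ivl) (auto simp: integrable_on_def)
    fix x :: real assume x: "x \<in> {-(pi/2)..pi/2}"
    show "\<bar>ln (sin x)\<bar> \<le> ln 2 - ln (x - 0)"
    proof (cases "x = 0")
      case False
      have e: "ln (sin x) = ln (sin \<bar>x\<bar>)" by (simp add: abs_if ln_minus)
      have "\<bar>x\<bar> / 2 \<le> sin \<bar>x\<bar>" using x by (intro half_le_sin) auto
      then have "ln (\<bar>x\<bar> / 2) \<le> ln (sin \<bar>x\<bar>)" using False by (intro ln_mono) auto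
      moreover have "ln (sin \<bar>x\<bar>) \<le> ln 1"
        using x False sin_gt_zero[of "\<bar>x\<bar>"] by (intro ln_mono) auto
      ultimately show ?thesis using e False by (simp add: ln_div ln_abs_real)
    qed simp
  qed auto
  have shift: "(\<lambda>x::real. ln (sin x)) integrable_on {c - pi..d - pi}"
    if "(\<lambda>x::real. ln (sin x)) integrable_on {c..d}" for c d
    using integrable_shift_real_ivl[OF that, of pi] by (simp add: ln_minus)
  have shift': "(\<lambda>x::real. ln (sin x)) integrable_on {c + pi..d + pi}"
    if "(\<lambda>x::real. ln (sin x)) integrable_on {c..d}" for c d
    using integrable_shift_real_ivl[OF that, of "-pi"] by (simp add: sin_diff ln_minus)
  have big: "(\<lambda>x::real. ln (sin x)) integrable_on {-(pi/2) - real m * pi..pi/2 + real m * pi}" for m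
  proof (induction m)
    case (Suc m)
    define c where "c = real m * pi"
    have c: "0 \<le> c" "real (Suc m) * pi = c + pi" by (auto simp: c_def algebra_simps)
    have I: "(\<lambda>x::real. ln (sin x)) integrable_on {-(pi/2) - c..pi/2 + c}"
      using Suc by (simp add: c_def)
    have "(\<lambda>x::real. ln (sin x)) integrable_on {-(pi/2) - c..pi/2 + c + pi}"
    proof (rule Henstock_Kurzweil_Integration.integrable_combine[where c = "pi/2 + c"])
      show "(\<lambda>x. ln (sin x)) integrable_on {pi / 2 + c..pi / 2 + c + pi}"
        by (rule integrable_subinterval_real[OF shift'[OF I]]) (use c in auto)
    qed (use I c in auto)
    moreover have "(\<lambda>x. ln (sin x)) integrable_on {-(pi/2) - c - pi..-(pi/2) - c}"
      by (rule integrable_subinterval_real[OF shift[OF I]]) (use c in auto)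
    ultimately have "(\<lambda>x::real. ln (sin x)) integrable_on {-(pi/2) - c - pi..pi/2 + c + pi}"
      by - (rule Henstock_Kurzweil_Integration.integrable_combine[where c = "-(pi/2) - c"], use c pi_gt3 in auto)
    then show ?case unfolding c by (simp add: algebra_simps)
  qed (use base in simp)
  obtain m :: nat where "max \<bar>a\<bar> \<bar>b\<bar> \<le> real m" using real_arch_simple by blast
  moreover have "real m \<le> real m * pi" using pi_gt3 by (simp add: mult_le_cancel_left1)
  ultimately have "{a..b} \<subseteq> {-(pi/2) - real m * pi..pi/2 + real m * pi}" using pi_gt3 by auto
  then show ?thesis by (rule integrable_subinterval_real[OF big])
qed

section \<open>The potential of a zone\<close>

text \<open>Here \<open>y\<close> is the inner product with the unit normal, so that
  \<open>arcsin y\<close> is the latitude, and the integration variable has been shifted by the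
  latitude.\<close>

definition zone_potential :: "real \<Rightarrow> real \<Rightarrow> real" where
  "zone_potential \<beta> y = integral {arcsin y - \<beta>..arcsin y + \<beta>} (\<lambda>t. ln (sin t))"

lemma sin_add_times_sin_diff:
  fixes x y :: real
  shows "sin (x + y) * sin (x - y) = (sin x)\<^sup>2 - (sin y)\<^sup>2"
proof -
  have "sin (x + y) * sin (x - y) = (sin x)\<^sup>2 * (cos y)\<^sup>2 - (cos x)\<^sup>2 * (sin y)\<^sup>2"
    by (simp add: sin_add sin_diff power2_eq_square algebra_simps)
  then show ?thesis by (simp add: cos_squared_eq algebra_simps)
qed

lemma finite_zeros_sin_shift: "finite {t \<in> {a..b}. sin (c + t) = (0::real)}"
proof -
  have "{t \<in> {a..b}. sin (c + t) = (0::real)} \<subseteq> (\<lambda>i. real_of_int i * pi - c) ` {\<lfloor>(a + c) / pi\<rfloor>..\<lceil>(b + c) / pi\<rceil>}"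
  proof
    fix t assume "t \<in> {t \<in> {a..b}. sin (c + t) = (0::real)}"
    then obtain i where t: "a \<le> t" "t \<le> b" "c + t = real_of_int i * pi"
      by (auto simp: sin_zero_iff_int2)
    have "(a + c) / pi \<le> i" "i \<le> (b + c) / pi"
      using t pi_gt_zero by (auto simp: field_simps)
    then have "i \<in> {\<lfloor>(a + c) / pi\<rfloor>..\<lceil>(b + c) / pi\<rceil>}" by (auto simp: floor_le_iff le_ceiling_iff)
    moreover have "t = real_of_int i * pi - c" using t by simp
    ultimately show "t \<in> (\<lambda>i. real_of_int i * pi - c) ` {\<lfloor>(a + c) / pi\<rfloor>..\<lceil>(b + c) / pi\<rceil>}" by blast
  qed
  then show ?thesis by (rule finite_subset) auto
qed

text \<open>Bounds the exceptional set on which \<open>ln\<close> of a product fails to split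
  because of \<open>ln 0 = 0\<close>.\<close>

lemma finite_sin_square_eq:
  assumes "\<bar>y\<bar> \<le> 1"
  shows "finite {t \<in> {a..b}. (sin t)\<^sup>2 = (y::real)\<^sup>2}"
proof -
  have "(sin t)\<^sup>2 = y\<^sup>2 \<longleftrightarrow> sin (arcsin y + t) = 0 \<or> sin (- arcsin y + t) = 0" for t
    using sin_add_times_sin_diff[of t "arcsin y"] assms
    by (auto simp: add.commute) 
  then have "{t \<in> {a..b}. (sin t)\<^sup>2 = y\<^sup>2}
      = {t \<in> {a..b}. sin (arcsin y + t) = 0} \<union> {t \<in> {a..b}. sin (- arcsin y + t) = 0}"
    by auto
  then show ?thesis
    using finite_zeros_sin_shift[of a b "arcsin y"] finite_zeros_sin_shift[of a b "- arcsin y"]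
    by (simp only: finite_Un)
qed

text \<open>Averaging over \<open>t\<close> and \<open>-t\<close> turns the integrand into half the
  logarithm of sin(\<phi> + t) sin(\<phi> - t), a difference of squares. The latitude then enters
  only through the square of \<open>y\<close>, which is why quadratics in the chart parameter appear
  later.\<close>

lemma has_integral_zone_potential:
  assumes "\<bar>y\<bar> \<le> 1"
  shows "((\<lambda>t. ln (y\<^sup>2 - (sin t)\<^sup>2) / 2) has_integral zone_potential \<beta> y) {-\<beta>..\<beta>}"
proof -
  let ?p = "arcsin y"
  have s: "sin ?p = y" using assms by simp
  have I: "((\<lambda>t. ln (sin t)) has_integral zone_potential \<beta> y) {?p - \<beta>..?p + \<beta>}"
    using ln_sin_integrable unfolding zone_potential_def by (rule integrable_integral)
  have 1: "((\<lambda>t. ln (sin (t + ?p))) has_integral zone_potential \<beta> y) {-\<beta>..\<beta>}"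
    using has_integral_shift_real_ivl[OF I, of ?p] by simp
  have 2: "((\<lambda>t. ln (sin (?p - t))) has_integral zone_potential \<beta> y) {-\<beta>..\<beta>}"
    using has_integral_reflect_real[of "\<lambda>t. ln (sin (t + ?p))" _ \<beta> "-\<beta>"] 1
    by (simp add: algebra_simps)
  have 3: "((\<lambda>t. (ln (sin (t + ?p)) + ln (sin (?p - t))) / 2) has_integral zone_potential \<beta> y) {-\<beta>..\<beta>}"
    using has_integral_divide[OF has_integral_add[OF 1 2], of 2] by simp
  show ?thesis
  proof (rule has_integral_spike_finite[OF finite_sin_square_eq[OF assms] _ 3])
    fix t assume "t \<in> {-\<beta>..\<beta>} - {t \<in> {-\<beta>..\<beta>}. (sin t)\<^sup>2 = y\<^sup>2}"
    then have "sin (?p + t) * sin (?p - t) \<noteq> 0"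
      using s sin_add_times_sin_diff[of ?p t] by auto
    then show "ln (y\<^sup>2 - (sin t)\<^sup>2) / 2 = (ln (sin (t + ?p)) + ln (sin (?p - t))) / 2"
      using sin_add_times_sin_diff[of ?p t, symmetric] s by (simp add: ln_mult add.commute)
  qed
qed

lemma zone_potential_minus: "\<bar>y\<bar> \<le> 1 \<Longrightarrow> zone_potential \<beta> (- y) = zone_potential \<beta> y"
  using has_integral_zone_potential[of y \<beta>] has_integral_zone_potential[of "-y" \<beta>]
  by (auto intro: has_integral_unique)

lemma zone_potential_abs: "\<bar>y\<bar> \<le> 1 \<Longrightarrow> zone_potential \<beta> \<bar>y\<bar> = zone_potential \<beta> y"
  by (cases "y \<ge> 0") (auto simp: zone_potential_minus)

text \<open>The integral runs over a full period \<open>pi\<close> of \<open>ln (sin t)\<close>, so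
  the location of the interval does not matter.\<close>

lemma zone_potential_half_pi:
  assumes "\<bar>y\<bar> \<le> 1"
  shows "zone_potential (pi/2) y = zone_potential (pi/2) 0"
proof -
  let ?f = "\<lambda>t::real. ln (sin t)"
  define p where "p = arcsin \<bar>y\<bar>"
  have p: "0 \<le> p" "p \<le> pi/2"
    using assms arcsin_le_arcsin[of 0 "\<bar>y\<bar>"] arcsin_ubound[of "\<bar>y\<bar>"] by (auto simp: p_def)
  have "zone_potential (pi/2) y = zone_potential (pi/2) \<bar>y\<bar>" using assms by (simp add: zone_potential_abs)
  also have "\<dots> = integral {p - pi/2..p + pi/2} ?f" by (simp add: zone_potential_def p_def)
  also have "\<dots> = integral {p - pi/2..pi/2} ?f + integral {pi/2..p + pi/2} ?f"
    using p by (intro Henstock_Kurzweil_Integration.integral_combine[symmetric] ln_sin_integrable) auto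
  also have "integral {pi/2..p + pi/2} ?f = integral {-(pi/2)..p - pi/2} ?f"
  proof -
    have "((\<lambda>t. ln (sin (t + pi))) has_integral integral {pi/2..p + pi/2} ?f) {pi/2 - pi..p + pi/2 - pi}"
      by (intro has_integral_shift_real_ivl integrable_integral ln_sin_integrable)
    then have "(?f has_integral integral {pi/2..p + pi/2} ?f) {-(pi/2)..p - pi/2}"
      by (simp add: ln_minus field_simps)
    then show ?thesis by (simp add: integral_unique)
  qed
  also have "integral {p - pi/2..pi/2} ?f + integral {-(pi/2)..p - pi/2} ?f = integral {-(pi/2)..pi/2} ?f"
    using p Henstock_Kurzweil_Integration.integral_combine[of "-(pi/2)" "p - pi/2" "pi/2" ?f] ln_sin_integrable by auto
  finally show ?thesis by (simp add: zone_potential_def)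
qed

text \<open>The constant sign turns integrability of these integrands into absolute integrability,
  as the exchange of integrals requires.\<close>

lemma ln_square_diff_sin_nonpos: "\<bar>y::real\<bar> \<le> 1 \<Longrightarrow> ln (y\<^sup>2 - (sin t)\<^sup>2) / 2 \<le> 0"
proof -
  assume y: "\<bar>y\<bar> \<le> 1"
  have "\<bar>y\<^sup>2 - (sin t)\<^sup>2\<bar> \<le> 1"
  proof -
    have "y\<^sup>2 \<le> 1" using power_mono[of "\<bar>y\<bar>" 1 2] y by simp
    moreover have "(sin t)\<^sup>2 \<le> 1" by (simp add: abs_square_le_1)
    moreover have "0 \<le> y\<^sup>2" "0 \<le> (sin t)\<^sup>2" by simp_all
    ultimately show ?thesis by (intro abs_leI) linarith+
  qed
  then have "ln \<bar>y\<^sup>2 - (sin t)\<^sup>2\<bar> \<le> 0" by (cases "y\<^sup>2 = (sin t)\<^sup>2") auto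
  then show ?thesis by (simp add: ln_abs_real)
qed

lemma uniformly_continuous_on_ln_sin_primitive:
  fixes a b c :: real
  assumes "a \<le> c"
  shows "uniformly_continuous_on {c..b} (\<lambda>x. integral {a..x} (\<lambda>t. ln (sin t)))"
  using ln_sin_integrable assms
  by (intro compact_uniformly_continuous continuous_on_subset[OF indefinite_integral_continuous_1]) auto

lemma zone_potential_primitive:
  assumes "a \<le> arcsin y - \<beta>" "0 \<le> \<beta>"
  shows "zone_potential \<beta> y =
     integral {a..arcsin y + \<beta>} (\<lambda>t. ln (sin t)) - integral {a..arcsin y - \<beta>} (\<lambda>t. ln (sin t))"
  unfolding zone_potential_def
  using Henstock_Kurzweil_Integration.integral_combine[of a "arcsin y - \<beta>" "arcsin y + \<beta>" "\<lambda>t. ln (sin t)"]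
    ln_sin_integrable assms by auto

lemma continuous_on_zone_potential:
  assumes "0 \<le> \<beta>"
  shows "continuous_on {-1..1} (zone_potential \<beta>)"
proof -
  define a where "a = - pi / 2 - \<beta>"
  have b: "arcsin y - \<beta> \<ge> a" "arcsin y + \<beta> \<ge> a" "arcsin y - \<beta> \<le> - a" "arcsin y + \<beta> \<le> - a" if "y \<in> {-1..1}" for y
    using that arcsin_bounded[of y] assms by (auto simp: a_def)
  have c: "continuous_on {a..-a} (\<lambda>x. integral {a..x} (\<lambda>t. ln (sin t)))"
    by (intro indefinite_integral_continuous_1 ln_sin_integrable)
  have "continuous_on {-1..1} (\<lambda>y. integral {a..arcsin y + \<beta>} (\<lambda>t. ln (sin t)) - integral {a..arcsin y - \<beta>} (\<lambda>t. ln (sin t)))"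
    by (intro continuous_on_diff continuous_on_compose2[OF c] continuous_intros)
      (use b in auto)
  then show ?thesis
    by (rule continuous_on_eq) (use b assms in \<open>auto intro!: zone_potential_primitive[symmetric]\<close>)
qed

text \<open>All end points \<plusminus> the half width around the latitude lie in
  \<open>{-pi..pi}\<close>, so uniform continuity of a single primitive there gives a \<delta> that
  works for every \<open>y\<close>. It serves to compare zones with slightly enlarged ones.\<close>

lemma zone_potential_uniformly_close:
  assumes "0 < \<epsilon>"
  obtains \<delta> where "0 < \<delta>"
    "\<And>y \<beta> \<beta>'. \<lbrakk>\<bar>y\<bar> \<le> 1; 0 \<le> \<beta>; \<beta> \<le> pi/2; 0 \<le> \<beta>'; \<beta>' \<le> pi/2; \<bar>\<beta> - \<beta>'\<bar> < \<delta>\<rbrakk>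
      \<Longrightarrow> \<bar>zone_potential \<beta> y - zone_potential \<beta>' y\<bar> < \<epsilon>"
proof -
  let ?L = "\<lambda>x. integral {-pi..x} (\<lambda>t. ln (sin t))"
  have "uniformly_continuous_on {-pi..pi} ?L"
    by (rule uniformly_continuous_on_ln_sin_primitive) simp
  then obtain \<delta> where \<delta>: "\<delta> > 0" "\<And>x x'. x \<in> {-pi..pi} \<Longrightarrow> x' \<in> {-pi..pi} \<Longrightarrow> \<bar>x' - x\<bar> < \<delta> \<Longrightarrow> \<bar>?L x' - ?L x\<bar> < \<epsilon> / 2"
    unfolding uniformly_continuous_on_def dist_real_def using assms by (metis half_gt_zero)
  show ?thesis
  proof (rule that[OF \<delta>(1)])
    fix y \<beta> \<beta>' :: real
    assume a: "\<bar>y\<bar> \<le> 1" "0 \<le> \<beta>" "\<beta> \<le> pi/2" "0 \<le> \<beta>'" "\<beta>' \<le> pi/2" "\<bar>\<beta> - \<beta>'\<bar> < \<delta>"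
    have p: "- (pi/2) \<le> arcsin y" "arcsin y \<le> pi/2" using arcsin_bounded[of y] a by auto
    have "\<bar>?L (arcsin y + \<beta>) - ?L (arcsin y + \<beta>')\<bar> < \<epsilon> / 2"
      using p a by (intro \<delta>) auto
    moreover have "\<bar>?L (arcsin y - \<beta>) - ?L (arcsin y - \<beta>')\<bar> < \<epsilon> / 2"
      using p a by (intro \<delta>) auto
    ultimately show "\<bar>zone_potential \<beta> y - zone_potential \<beta>' y\<bar> < \<epsilon>"
      using p a by (subst (1 2) zone_potential_primitive[of "-pi"]) linarith+
  qed
qed

section \<open>Logarithmic integrals of quadratics along a great circle\<close>

lemma complex_quadratic_roots:
  fixes b c :: complex
  obtains r s where "r + s = - b" "r * s = c"
proof
  define w where "w = csqrt (b\<^sup>2 - 4 * c)"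
  show "(- b + w) / 2 + (- b - w) / 2 = - b" by (simp add: field_simps)
  have "(- b + w) / 2 * ((- b - w) / 2) = (b\<^sup>2 - w\<^sup>2) / 4"
    by (simp add: power2_eq_square field_simps)
  also have "\<dots> = c" by (simp add: w_def)
  finally show "(- b + w) / 2 * ((- b - w) / 2) = c" .
qed

lemma integral_ln_quadratic_roots:
  fixes b c :: real
  assumes "r + s = - complex_of_real b" "r * s = complex_of_real c"
  shows "((\<lambda>u. ln (u\<^sup>2 + b * u + c)) has_integral
     integral {-R..R} (\<lambda>u. ln (cmod (of_real u - r))) + integral {-R..R} (\<lambda>u. ln (cmod (of_real u - s)))) {-R..R}"
proof -
  have e: "cmod (of_real u - r) * cmod (of_real u - s) = \<bar>u\<^sup>2 + b * u + c\<bar>" for u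
  proof -
    have "(of_real u - r) * (of_real u - s) = of_real u * of_real u - (r + s) * of_real u + r * s"
      by (simp add: algebra_simps)
    also have "\<dots> = of_real (u\<^sup>2 + b * u + c)" by (simp add: assms power2_eq_square)
    finally show ?thesis by (metis norm_mult norm_of_real)
  qed
  have I: "((\<lambda>u. ln (cmod (of_real u - r)) + ln (cmod (of_real u - s))) has_integral
     integral {-R..R} (\<lambda>u. ln (cmod (of_real u - r))) + integral {-R..R} (\<lambda>u. ln (cmod (of_real u - s)))) {-R..R}"
    by (intro has_integral_add integrable_integral integrable_ln_cmod)
  show ?thesis
  \<comment> \<open>A real root equals its real part, so this set contains every point where the
    logarithm of the product does not split.\<close>
  proof (rule has_integral_spike_finite[OF _ _ I, of "{Re r, Re s}"])
    fix u assume "u \<in> {-R..R} - {Re r, Re s}"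
    then have "of_real u \<noteq> r" "of_real u \<noteq> s" by auto
    then have "ln (cmod (of_real u - r)) + ln (cmod (of_real u - s)) = ln \<bar>u\<^sup>2 + b * u + c\<bar>"
      unfolding e[symmetric] by (simp add: ln_mult)
    then show "ln (u\<^sup>2 + b * u + c) = ln (cmod (of_real u - r)) + ln (cmod (of_real u - s))"
      by (simp add: ln_abs_real)
  qed simp
qed

lemma integrable_ln_quadratic:
  fixes b c :: real
  shows "(\<lambda>u. ln (u\<^sup>2 + b * u + c)) integrable_on {-R..R}"
  by (rule complex_quadratic_roots[of "of_real b" "of_real c"])
    (use integral_ln_quadratic_roots in blast)

text \<open>Each complex root contributes its own lower bound. Since \<open>b\<close> is minus the
  sum of the roots, a large \<bar>b\<bar> forces one of them to have modulus at least
  \<open>2 * R\<close>, which improves its share by \<open>2 * R\<close>.\<close>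

lemma integral_ln_quadratic_ge:
  fixes b c R :: real
  assumes "0 < R"
  shows "integral {-R..R} (\<lambda>u. ln (u\<^sup>2 + b * u + c)) \<ge> 4 * R * ln R - 4 * R"
    and "4 * R \<le> \<bar>b\<bar> \<Longrightarrow> integral {-R..R} (\<lambda>u. ln (u\<^sup>2 + b * u + c)) \<ge> 4 * R * ln R - 2 * R"
proof -
  obtain r s where rs: "r + s = - complex_of_real b" "r * s = complex_of_real c"
    by (rule complex_quadratic_roots)
  note I = integral_unique[OF integral_ln_quadratic_roots[OF rs, of R]]
  note ge = integral_ln_cmod_ge[OF assms]
  show "integral {-R..R} (\<lambda>u. ln (u\<^sup>2 + b * u + c)) \<ge> 4 * R * ln R - 4 * R"
    unfolding I using ge[of r] ge[of s] by linarith
  assume b: "4 * R \<le> \<bar>b\<bar>"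
  have "\<bar>b\<bar> = cmod (r + s)" by (simp add: rs(1))
  also have "\<dots> \<le> cmod r + cmod s" by (rule norm_triangle_ineq)
  finally have "2 * R \<le> cmod r \<or> 2 * R \<le> cmod s" using b by linarith
  then show "integral {-R..R} (\<lambda>u. ln (u\<^sup>2 + b * u + c)) \<ge> 4 * R * ln R - 2 * R"
    unfolding I using ge[of r] ge[of s] integral_ln_cmod_ge_of_large[OF assms, of r]
      integral_ln_cmod_ge_of_large[OF assms, of s] by linarith
qed

lemma integral_ln_quadratic_le:
  fixes p q C R :: real
  assumes "\<bar>p\<bar> \<le> C" "\<bar>q\<bar> \<le> C" "C < R"
  shows "integral {-R..R} (\<lambda>u. ln (u\<^sup>2 + (- p - q) * u + p * q)) \<le> 4 * R * ln R - 4 * R + 4 * C\<^sup>2 / R"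
proof -
  have e: "ln (cmod (of_real u - of_real x)) = ln (u - x)" for u x
    by (metis ln_abs_real norm_of_real of_real_diff)
  have sq: "2 * x\<^sup>2 / R \<le> 2 * C\<^sup>2 / R" if "\<bar>x\<bar> \<le> C" for x
    using that assms power_mono[of "\<bar>x\<bar>" C 2] by (intro divide_right_mono mult_left_mono) auto
  have "integral {-R..R} (\<lambda>u. ln (u\<^sup>2 + (- p - q) * u + p * q))
     = integral {-R..R} (\<lambda>u. ln (u - p)) + integral {-R..R} (\<lambda>u. ln (u - q))"
    using integral_unique[OF integral_ln_quadratic_roots[of "of_real p" "of_real q" "- p - q" "p * q" R]]
    by (simp add: e)
  also have "\<dots> \<le> (2 * R * ln R - 2 * R + 2 * p\<^sup>2 / R) + (2 * R * ln R - 2 * R + 2 * q\<^sup>2 / R)"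
    using assms by (intro add_mono integral_ln_real_le) auto
  also have "\<dots> \<le> 4 * R * ln R - 4 * R + 4 * C\<^sup>2 / R"
    using sq[OF assms(1)] sq[OF assms(2)] by linarith
  finally show ?thesis .
qed

text \<open>The value at \<open>(u x + e) / sqrt (1 + u\<^sup>2)\<close> of a linear form with values \<open>A\<close> at \<open>x\<close> and \<open>B\<close> at \<open>e\<close>;
  the point \<open>x\<close> itself is at infinity in this chart.\<close>

definition chart :: "real \<Rightarrow> real \<Rightarrow> real \<Rightarrow> real" where
  "chart A B u = (A * u + B) / sqrt (1 + u\<^sup>2)"

lemma one_plus_square_pos: "0 < 1 + (u::real)\<^sup>2"
  by (simp add: add_pos_nonneg)

lemma chart_square: "(chart A B u)\<^sup>2 = (A * u + B)\<^sup>2 / (1 + u\<^sup>2)"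
  using one_plus_square_pos[of u] by (simp add: chart_def power_divide)

lemma abs_chart_le_one:
  assumes "A\<^sup>2 + B\<^sup>2 \<le> 1"
  shows "\<bar>chart A B u\<bar> \<le> 1"
proof -
  have "(A * u + B)\<^sup>2 \<le> (A * u + B)\<^sup>2 + (A - B * u)\<^sup>2" by simp
  also have "\<dots> = (A\<^sup>2 + B\<^sup>2) * (1 + u\<^sup>2)" by (simp add: power2_eq_square algebra_simps)
  also have "\<dots> \<le> 1 * (1 + u\<^sup>2)" using assms one_plus_square_pos[of u] by (intro mult_right_mono) auto
  finally have "(chart A B u)\<^sup>2 \<le> 1"
    using one_plus_square_pos[of u] by (simp add: chart_square)
  then show ?thesis by (simp add: abs_square_le_1)
qed

lemma continuous_on_chart: "continuous_on S (chart A B)"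
  unfolding chart_def using one_plus_square_pos
  by (intro continuous_intros) (metis less_irrefl real_sqrt_eq_zero_cancel_iff)

text \<open>The difference of squares equals its leading coefficient times a monic quadratic,
  divided by 1 plus the square of \<open>u\<close>; \<open>b\<close> and \<open>c\<close> are the
  coefficients of that quadratic, and the three logarithms are integrated separately.\<close>

lemma has_integral_ln_chart:
  fixes A B s R :: real
  assumes "A\<^sup>2 \<noteq> s\<^sup>2" "0 \<le> R"
  defines "b \<equiv> 2 * A * B / (A\<^sup>2 - s\<^sup>2)" and "c \<equiv> (B\<^sup>2 - s\<^sup>2) / (A\<^sup>2 - s\<^sup>2)"
  shows "((\<lambda>u. ln ((chart A B u)\<^sup>2 - s\<^sup>2) / 2) has_integral
     (2 * R * ln (A\<^sup>2 - s\<^sup>2) + integral {-R..R} (\<lambda>u. ln (u\<^sup>2 + b * u + c))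
        - (2 * R * ln (1 + R\<^sup>2) - 4 * R + 4 * arctan R)) / 2) {-R..R}"
proof -
  have \<delta>: "A\<^sup>2 - s\<^sup>2 \<noteq> 0" using assms by simp
  have e: "(chart A B u)\<^sup>2 - s\<^sup>2 = (A\<^sup>2 - s\<^sup>2) * (u\<^sup>2 + b * u + c) / (1 + u\<^sup>2)" for u
  proof -
    have "(A\<^sup>2 - s\<^sup>2) * (u\<^sup>2 + b * u + c) = (A\<^sup>2 - s\<^sup>2) * u\<^sup>2 + 2 * A * B * u + (B\<^sup>2 - s\<^sup>2)"
      using \<delta> by (simp add: b_def c_def distrib_left)
    also have "\<dots> = (A * u + B)\<^sup>2 - s\<^sup>2 * (1 + u\<^sup>2)"
      by (simp add: power2_eq_square algebra_simps)
    finally show ?thesis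
      using one_plus_square_pos[of u] by (simp add: chart_square diff_divide_distrib)
  qed
  have fin: "finite {u. u\<^sup>2 + b * u + c = 0}"
  proof -
    have "finite {x. poly [:c, b, 1:] x = 0}" by (intro poly_roots_finite) simp
    moreover have "{x. poly [:c, b, 1:] x = 0} = {u. u\<^sup>2 + b * u + c = 0}"
      by (simp add: algebra_simps power2_eq_square)
    ultimately show ?thesis by simp
  qed
  have const: "((\<lambda>u. ln (A\<^sup>2 - s\<^sup>2)) has_integral 2 * R * ln (A\<^sup>2 - s\<^sup>2)) {-R..R}"
    using has_integral_const_real[of "ln (A\<^sup>2 - s\<^sup>2)" "-R" R] assms by simp
  have I: "((\<lambda>u. (ln (A\<^sup>2 - s\<^sup>2) + ln (u\<^sup>2 + b * u + c) - ln (1 + u\<^sup>2)) / 2) has_integral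
     (2 * R * ln (A\<^sup>2 - s\<^sup>2) + integral {-R..R} (\<lambda>u. ln (u\<^sup>2 + b * u + c))
        - (2 * R * ln (1 + R\<^sup>2) - 4 * R + 4 * arctan R)) / 2) {-R..R}"
    by (intro has_integral_divide has_integral_diff has_integral_add const
        has_integral_ln_one_plus_square integrable_integral integrable_ln_quadratic assms(2))
  show ?thesis
  proof (rule has_integral_spike_finite[OF fin _ I])
    fix u assume "u \<in> {-R..R} - {u. u\<^sup>2 + b * u + c = 0}"
    then show "ln ((chart A B u)\<^sup>2 - s\<^sup>2) / 2 = (ln (A\<^sup>2 - s\<^sup>2) + ln (u\<^sup>2 + b * u + c) - ln (1 + u\<^sup>2)) / 2"
      using \<delta> one_plus_square_pos[of u] unfolding e by (simp add: ln_div ln_mult)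
  qed
qed

lemma ln_one_plus_square_bounds:
  fixes R :: real
  assumes "0 < R"
  shows "2 * R * ln R \<le> R * ln (1 + R\<^sup>2)" "R * ln (1 + R\<^sup>2) \<le> 2 * R * ln R + 1 / R"
proof -
  have "ln (R\<^sup>2) \<le> ln (1 + R\<^sup>2)" using assms by (intro ln_mono) auto
  then have "2 * ln R \<le> ln (1 + R\<^sup>2)" by (simp add: ln_realpow)
  then show "2 * R * ln R \<le> R * ln (1 + R\<^sup>2)" using assms by (simp add: mult.left_commute mult.assoc)
  have "1 + R\<^sup>2 = R\<^sup>2 * (1 + 1 / R\<^sup>2)" using assms by (simp add: distrib_left)
  moreover have "1 + 1 / R\<^sup>2 > 0" by (simp add: add_pos_nonneg)
  ultimately have "ln (1 + R\<^sup>2) = ln (R\<^sup>2) + ln (1 + 1 / R\<^sup>2)" using assms by (metis ln_mult_pos zero_less_power)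
  also have "\<dots> \<le> 2 * ln R + 1 / R\<^sup>2" using ln_add_one_self_le_self[of "1 / R\<^sup>2"] by (simp add: ln_realpow)
  finally have "R * ln (1 + R\<^sup>2) \<le> R * (2 * ln R + 1 / R\<^sup>2)" using assms by (intro mult_left_mono) auto
  also have "\<dots> = 2 * R * ln R + 1 / R" using assms by (simp add: distrib_left power2_eq_square)
  finally show "R * ln (1 + R\<^sup>2) \<le> 2 * R * ln R + 1 / R" .
qed

section \<open>Contribution of one zone to the integral along a great circle\<close>

text \<open>For one fixed \<open>t\<close>, the integral over the chart of the integrand of the
  potential at the moving point minus the one at the base point. The latter is constant in
  \<open>u\<close>: length \<open>2 * R\<close> times half a logarithm.\<close>

definition chart_excess :: "real \<Rightarrow> real \<Rightarrow> real \<Rightarrow> real \<Rightarrow> real" where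
  "chart_excess A B R t =
     integral {-R..R} (\<lambda>u. ln ((chart A B u)\<^sup>2 - (sin t)\<^sup>2) / 2) - R * ln (A\<^sup>2 - (sin t)\<^sup>2)"

lemma chart_excess_eq:
  assumes "0 \<le> R" "A\<^sup>2 \<noteq> (sin t)\<^sup>2"
  shows "chart_excess A B R t =
     (integral {-R..R} (\<lambda>u. ln (u\<^sup>2 + 2 * A * B / (A\<^sup>2 - (sin t)\<^sup>2) * u
          + (B\<^sup>2 - (sin t)\<^sup>2) / (A\<^sup>2 - (sin t)\<^sup>2)))
        - (2 * R * ln (1 + R\<^sup>2) - 4 * R + 4 * arctan R)) / 2"
  unfolding chart_excess_def integral_unique[OF has_integral_ln_chart[OF assms(2,1), of B]]
  by (simp add: add_divide_distrib diff_divide_distrib)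

text \<open>The terms in \<open>R * ln R\<close> and \<open>R\<close> from the quadratic and from
  the denominator cancel, leaving the arctangent and an error \<open>1 / R\<close>. The hypothesis
  of the second bound says that the linear coefficient of the quadratic has modulus at least
  \<open>4 * R\<close>.\<close>

lemma chart_excess_ge:
  assumes "0 < R" "A\<^sup>2 \<noteq> (sin t)\<^sup>2"
  shows "chart_excess A B R t \<ge> - (pi + 1 / R)"
    and "2 * R * \<bar>A\<^sup>2 - (sin t)\<^sup>2\<bar> \<le> \<bar>A * B\<bar> \<Longrightarrow> chart_excess A B R t \<ge> - (pi + 1 / R) + R"
proof -
  define b where "b = 2 * A * B / (A\<^sup>2 - (sin t)\<^sup>2)"
  define c where "c = (B\<^sup>2 - (sin t)\<^sup>2) / (A\<^sup>2 - (sin t)\<^sup>2)"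
  have E: "chart_excess A B R t =
     (integral {-R..R} (\<lambda>u. ln (u\<^sup>2 + b * u + c)) - (2 * R * ln (1 + R\<^sup>2) - 4 * R + 4 * arctan R)) / 2"
    unfolding b_def c_def by (rule chart_excess_eq) (use assms in auto)
  have at: "arctan R \<le> pi / 2" using arctan_ubound[of R] by simp
  note ln = ln_one_plus_square_bounds(2)[OF assms(1)]
  note ge = integral_ln_quadratic_ge[OF assms(1), of b c]
  show "chart_excess A B R t \<ge> - (pi + 1 / R)"
    unfolding E using ge(1) at ln by (simp add: field_simps)
  assume "2 * R * \<bar>A\<^sup>2 - (sin t)\<^sup>2\<bar> \<le> \<bar>A * B\<bar>"
  then have "4 * R \<le> \<bar>b\<bar>" using assms by (simp add: b_def abs_divide abs_mult field_simps)
  then show "chart_excess A B R t \<ge> - (pi + 1 / R) + R"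
    unfolding E using ge(2) at ln by (simp add: field_simps)
qed

text \<open>On a circle through the pole, the quadratic has discriminant a positive multiple of the
  square of \<open>sin t * cos t\<close>, hence real roots. The condition on \<open>C\<close> bounds
  them, their numerators being at most 2 in absolute value, so the upper estimate for real roots
  applies.\<close>

lemma chart_excess_le:
  assumes "A\<^sup>2 + B\<^sup>2 = 1" "A\<^sup>2 < (sin t)\<^sup>2" "2 \<le> C * ((sin t)\<^sup>2 - A\<^sup>2)" "C < R"
  shows "chart_excess A B R t \<le> 2 * C\<^sup>2 / R - 2 * arctan R"
proof -
  define \<delta> where "\<delta> = A\<^sup>2 - (sin t)\<^sup>2"
  \<comment> \<open>\<open>p\<close> and \<open>q\<close> are the two roots by the quadratic
    formula.\<close>
  define p where "p = (- A * B + sin t * cos t) / \<delta>"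
  define q where "q = (- A * B - sin t * cos t) / \<delta>"
  have \<delta>: "\<delta> < 0" "2 \<le> C * \<bar>\<delta>\<bar>" using assms by (auto simp: \<delta>_def)
  have C: "0 < C" using \<delta> by (smt (verit) zero_less_mult_pos2)
  have R: "0 < R" using C assms by simp
  have "\<bar>A * B\<bar> \<le> 1"
    using assms(1) sum_squares_bound[of "\<bar>A\<bar>" "\<bar>B\<bar>"] by (simp add: abs_mult)
  moreover have "\<bar>sin t * cos t\<bar> \<le> 1"
    by (simp add: abs_mult mult_le_one)
  ultimately have "\<bar>- A * B + sin t * cos t\<bar> \<le> 2" "\<bar>- A * B - sin t * cos t\<bar> \<le> 2" by auto
  then have "\<bar>- A * B + sin t * cos t\<bar> \<le> C * \<bar>\<delta>\<bar>" "\<bar>- A * B - sin t * cos t\<bar> \<le> C * \<bar>\<delta>\<bar>"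
    using \<delta> by linarith+
  then have pq: "\<bar>p\<bar> \<le> C" "\<bar>q\<bar> \<le> C"
    using \<delta> by (simp_all only: p_def q_def abs_divide pos_divide_le_eq[of "\<bar>\<delta>\<bar>"] zero_less_abs_iff)
  have 1: "2 * A * B / \<delta> = - p - q" using \<delta> by (simp add: p_def q_def field_simps)
  have 2: "(B\<^sup>2 - (sin t)\<^sup>2) / \<delta> = p * q"
  proof -
    have "(- A * B + sin t * cos t) * (- A * B - sin t * cos t) = A\<^sup>2 * B\<^sup>2 - (sin t)\<^sup>2 * (cos t)\<^sup>2"
      by (simp add: power2_eq_square algebra_simps)
    also have "\<dots> = (B\<^sup>2 - (sin t)\<^sup>2) * \<delta>"
    proof -
      have B: "B\<^sup>2 = 1 - A\<^sup>2" using assms by simp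
      show ?thesis unfolding B \<delta>_def cos_squared_eq by (simp add: algebra_simps)
    qed
    finally show ?thesis using \<delta> by (simp add: p_def q_def)
  qed
  have "chart_excess A B R t =
     (integral {-R..R} (\<lambda>u. ln (u\<^sup>2 + (- p - q) * u + p * q)) - (2 * R * ln (1 + R\<^sup>2) - 4 * R + 4 * arctan R)) / 2"
    unfolding 1[symmetric] 2[symmetric] \<delta>_def by (rule chart_excess_eq) (use assms R in auto)
  then show ?thesis
    using integral_ln_quadratic_le[OF pq assms(4)] ln_one_plus_square_bounds(1)[OF R]
    by (simp add: field_simps)
qed

text \<open>The exchange of the integral over the chart with the integral over the zone, by Fubini
  on a rectangle.\<close>

lemma has_integral_chart_excess:
  assumes "0 < R" "0 \<le> \<beta>" "A\<^sup>2 + B\<^sup>2 \<le> 1"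
  shows "(chart_excess A B R has_integral
    integral {-R..R} (\<lambda>u. zone_potential \<beta> (chart A B u) - zone_potential \<beta> A)) {-\<beta>..\<beta>}"
proof -
  define h where "h = (\<lambda>u t. ln ((chart A B u)\<^sup>2 - (sin t)\<^sup>2) / 2)"
  define F where "F = (\<lambda>u t. indicator {-R..R} u * (indicator {-\<beta>..\<beta>} t * h u t))"
  define K where "K = (\<lambda>t. integral {-R..R} (\<lambda>u. h u t))"
  have "A\<^sup>2 \<le> 1" using assms(3) by (smt (verit) zero_le_power2)
  then have A: "\<bar>A\<bar> \<le> 1" by (simp add: abs_square_le_1)
  have y: "\<bar>chart A B u\<bar> \<le> 1" for u by (rule abs_chart_le_one[OF assms(3)])
  have h0: "h u t \<le> 0" for u t unfolding h_def by (rule ln_square_diff_sin_nonpos[OF y])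
  have [measurable]: "chart A B \<in> borel_measurable borel"
    by (intro borel_measurable_continuous_onI continuous_on_chart)
  have Fm: "(\<lambda>(u, t). F u t) \<in> borel_measurable (lborel \<Otimes>\<^sub>M lborel)"
    unfolding F_def h_def by measurable
  \<comment> \<open>Bridge between the two integrals: a nonpositive Borel function integrable over
    an interval in the gauge sense is Lebesgue integrable there with the same value.\<close>
  have leb: "integrable lborel (\<lambda>x. indicator {a..b} x * f x) \<and>
      (LBINT x. indicator {a..b} x * f x) = integral {a..b} f"
    if f: "f integrable_on {a..b}" "\<And>x. f x \<le> 0" and [measurable]: "f \<in> borel_measurable borel"
    for f :: "real \<Rightarrow> real" and a b
  proof -
    have "(\<lambda>x. - f x) absolutely_integrable_on {a..b}"
      using f by (intro nonnegative_absolutely_integrable_1 integrable_neg) auto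
    then have "f absolutely_integrable_on {a..b}" 
      unfolding set_integrable_def by simp
    then have 1: "set_integrable lborel {a..b} f"
      unfolding set_integrable_def by (subst (asm) integrable_completion) auto
    show ?thesis
      using set_borel_integral_eq_integral(2)[OF 1] 1
      by (simp add: set_integrable_def set_lebesgue_integral_def)
  qed
  have ht: "integrable lborel (\<lambda>t. indicator {-\<beta>..\<beta>} t * h u t)"
      "(LBINT t. indicator {-\<beta>..\<beta>} t * h u t) = zone_potential \<beta> (chart A B u)" for u
  proof -
    have I: "(h u has_integral zone_potential \<beta> (chart A B u)) {-\<beta>..\<beta>}"
      unfolding h_def by (rule has_integral_zone_potential[OF y])
    have m: "h u \<in> borel_measurable borel" unfolding h_def by measurable
    show "integrable lborel (\<lambda>t. indicator {-\<beta>..\<beta>} t * h u t)"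
      "(LBINT t. indicator {-\<beta>..\<beta>} t * h u t) = zone_potential \<beta> (chart A B u)"
      using leb[of "h u" "-\<beta>" \<beta>, OF has_integral_integrable[OF I] h0 m] integral_unique[OF I] by auto
  qed
  have cz: "continuous_on {-R..R} (\<lambda>u. zone_potential \<beta> (chart A B u))"
    using y by (intro continuous_on_compose2[OF continuous_on_zone_potential[OF assms(2)] continuous_on_chart])
      (auto simp: abs_le_iff minus_le_iff)
  have Fi: "integrable (lborel \<Otimes>\<^sub>M lborel) (\<lambda>(u, t). F u t)"
  proof (rule lborel_pair.Fubini_integrable[OF Fm])
    have "integrable lborel (\<lambda>u. indicator {-R..R} u *\<^sub>R (- zone_potential \<beta> (chart A B u)))"
      by (intro borel_integrable_compact continuous_on_minus cz) auto
    moreover have "(LBINT t. norm (F u t)) = indicator {-R..R} u *\<^sub>R (- zone_potential \<beta> (chart A B u))" for u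
    proof -
      have "norm (F u t) = indicator {-R..R} u * (- (indicator {-\<beta>..\<beta>} t * h u t))" for t
        using h0[of u t] by (auto simp: F_def indicator_def)
      then show ?thesis using ht(2)[of u] by simp
    qed
    ultimately show "integrable lborel (\<lambda>u. LBINT t. norm (case (u, t) of (u, t) \<Rightarrow> F u t))" by simp
    show "AE u in lborel. integrable lborel (\<lambda>t. case (u, t) of (u, t) \<Rightarrow> F u t)"
      using ht(1) by (auto simp: F_def)
  qed
  have snd: "integrable lborel (\<lambda>t. LBINT u. F u t)"
    using lborel_pair.integrable_snd[OF Fi] by simp
  have "(LBINT t. LBINT u. F u t) = (LBINT u. LBINT t. F u t)"
    using lborel_pair.Fubini_integral[OF Fi] .
  also have "\<dots> = (LBINT u. indicator {-R..R} u * zone_potential \<beta> (chart A B u))"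
    by (simp add: F_def ht(2))
  also have "\<dots> = integral {-R..R} (\<lambda>u. zone_potential \<beta> (chart A B u))"
  proof -
    have "set_integrable lborel {-R..R} (\<lambda>u. zone_potential \<beta> (chart A B u))"
      unfolding set_integrable_def by (intro borel_integrable_compact cz) auto
    from set_borel_integral_eq_integral(2)[OF this] show ?thesis
      by (simp add: set_lebesgue_integral_def)
  qed
  finally have "((\<lambda>t. LBINT u. F u t) has_integral integral {-R..R} (\<lambda>u. zone_potential \<beta> (chart A B u))) UNIV"
    using has_integral_integral_lborel[OF snd] by simp
  moreover have "(\<lambda>t. LBINT u. F u t) = (\<lambda>t. if t \<in> {-\<beta>..\<beta>} then LBINT u. indicator {-R..R} u * h u t else 0)"
    by (simp add: F_def indicator_def fun_eq_iff)
  ultimately have I: "((\<lambda>t. LBINT u. indicator {-R..R} u * h u t) has_integral integral {-R..R} (\<lambda>u. zone_potential \<beta> (chart A B u))) {-\<beta>..\<beta>}"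
    by (simp only: has_integral_restrict_UNIV)
  have "(K has_integral integral {-R..R} (\<lambda>u. zone_potential \<beta> (chart A B u))) {-\<beta>..\<beta>}"
  \<comment> \<open>For the finitely many \<open>t\<close> at the latitude of the base point, the
    explicit integral over the chart was not established, so they are discarded.\<close>
  proof (rule has_integral_spike_finite[OF finite_sin_square_eq[OF A] _ I])
    fix t assume "t \<in> {-\<beta>..\<beta>} - {t \<in> {-\<beta>..\<beta>}. (sin t)\<^sup>2 = A\<^sup>2}"
    then have "A\<^sup>2 \<noteq> (sin t)\<^sup>2" by auto
    then have "(\<lambda>u. h u t) integrable_on {-R..R}"
      unfolding h_def using has_integral_ln_chart assms(1) by (blast intro: less_imp_le)
    moreover have "(\<lambda>u. h u t) \<in> borel_measurable borel" unfolding h_def by measurable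
    ultimately show "K t = (LBINT u. indicator {-R..R} u * h u t)"
      using leb[of "\<lambda>u. h u t" "-R" R] h0 by (simp add: K_def)
  qed
  moreover have "((\<lambda>t. 2 * R * (ln (A\<^sup>2 - (sin t)\<^sup>2) / 2)) has_integral 2 * R * zone_potential \<beta> A) {-\<beta>..\<beta>}"
    by (intro has_integral_mult_right has_integral_zone_potential A)
  ultimately have "((\<lambda>t. K t - 2 * R * (ln (A\<^sup>2 - (sin t)\<^sup>2) / 2)) has_integral
      integral {-R..R} (\<lambda>u. zone_potential \<beta> (chart A B u)) - 2 * R * zone_potential \<beta> A) {-\<beta>..\<beta>}"
    by (rule has_integral_diff)
  moreover have "(\<lambda>t. K t - 2 * R * (ln (A\<^sup>2 - (sin t)\<^sup>2) / 2)) = chart_excess A B R"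
    by (simp add: K_def h_def chart_excess_def fun_eq_iff)
  moreover have "integral {-R..R} (\<lambda>u. zone_potential \<beta> (chart A B u) - zone_potential \<beta> A) =
      integral {-R..R} (\<lambda>u. zone_potential \<beta> (chart A B u)) - 2 * R * zone_potential \<beta> A"
    using assms(1) by (subst integral_diff) (auto intro!: integrable_continuous_interval cz)
  ultimately show ?thesis by simp
qed

lemma integral_zone_potential_chart_ge:
  assumes "0 < R" "0 \<le> \<beta>" "A\<^sup>2 + B\<^sup>2 \<le> 1"
  shows "integral {-R..R} (\<lambda>u. zone_potential \<beta> (chart A B u) - zone_potential \<beta> A)
    \<ge> - (2 * \<beta> * (pi + 1 / R))"
proof -
  have "A\<^sup>2 \<le> 1" using assms(3) by (smt (verit) zero_le_power2)
  then have A: "\<bar>A\<bar> \<le> 1" by (simp add: abs_square_le_1)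
  have "((\<lambda>t. - (pi + 1 / R)) has_integral - (2 * \<beta> * (pi + 1 / R))) {-\<beta>..\<beta>}"
    using has_integral_const_real[of "- (pi + 1 / R)" "-\<beta>" \<beta>] assms(2) by (simp add: algebra_simps)
  \<comment> \<open>At the exceptional \<open>t\<close> the minorant is given the value of the
    excess itself, so that the comparison holds at every point.\<close>
  then have "((\<lambda>t. if (sin t)\<^sup>2 = A\<^sup>2 then chart_excess A B R t else - (pi + 1 / R)) has_integral - (2 * \<beta> * (pi + 1 / R))) {-\<beta>..\<beta>}"
    by (rule has_integral_spike_finite[OF finite_sin_square_eq[OF A], rotated]) auto
  then show ?thesis
    by (rule has_integral_le[OF _ has_integral_chart_excess[OF assms]])
      (use chart_excess_ge(1)[OF assms(1)] in auto)
qed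

text \<open>For \<open>t\<close> within distance \<open>O(1/R)\<close> of the latitude of the base point, one root of the quadratic is
  larger than \<open>2 R\<close> and contributes an extra \<open>R\<close>; hence the gain is bounded below independently of \<open>R\<close>.\<close>

lemma integral_zone_potential_chart_ge_inside:
  assumes "0 < R" "0 < \<beta>" "\<beta> \<le> pi / 2" "A\<^sup>2 + B\<^sup>2 \<le> 1" "\<bar>A\<bar> < sin \<beta>"
    and R: "\<bar>A * B\<bar> \<le> 2 * R * (\<beta> - arcsin \<bar>A\<bar>)"
  shows "integral {-R..R} (\<lambda>u. zone_potential \<beta> (chart A B u) - zone_potential \<beta> A)
    \<ge> \<bar>A * B\<bar> / 2 - 2 * \<beta> * (pi + 1 / R)"
proof -
  have "A\<^sup>2 \<le> 1" using assms(4) by (smt (verit) zero_le_power2)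
  then have A: "\<bar>A\<bar> \<le> 1" by (simp add: abs_square_le_1)
  define p where "p = arcsin \<bar>A\<bar>"
  \<comment> \<open>For \<open>t\<close> in \<open>{p..p + w}\<close> the squares of
    \<open>A\<close> and \<open>sin t\<close> differ by at most \<open>w\<close>, which meets the
    condition for the extra \<open>R\<close>. The extra therefore adds \<open>R * w\<close>, half of
    \<bar>A * B\<bar>; the hypothesis on \<open>R\<close> keeps \<open>p + w\<close> below
    \<beta>.\<close>
  define w where "w = \<bar>A * B\<bar> / (2 * R)"
  have w: "0 \<le> w" "w \<le> \<beta> - p" "R * w = \<bar>A * B\<bar> / 2"
    using R assms(1) by (auto simp: w_def p_def field_simps)
  have p: "0 \<le> p" "sin p = \<bar>A\<bar>" using A arcsin_le_arcsin[of 0 "\<bar>A\<bar>"] by (auto simp: p_def)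
  let ?c = "- (pi + 1 / R)"
  let ?g = "\<lambda>t. (if t \<in> {p..p + w} then R else 0) + ?c"
  have 1: "((\<lambda>t. ?c) has_integral - (2 * \<beta> * (pi + 1 / R))) {-\<beta>..\<beta>}"
    using has_integral_const_real[of ?c "-\<beta>" \<beta>] assms(2) by (simp add: algebra_simps)
  have "((\<lambda>t. R) has_integral R * w) {p..p + w}"
    using has_integral_const_real[of R p "p + w"] w(1) by (simp add: mult.commute)
  then have 2: "((\<lambda>t. if t \<in> {p..p + w} then R else 0) has_integral R * w) {-\<beta>..\<beta>}"
    by (subst has_integral_restrict) (use p(1) w(1,2) assms(2) in auto)
  have g: "(?g has_integral R * w + - (2 * \<beta> * (pi + 1 / R))) {-\<beta>..\<beta>}"
    by (rule has_integral_add[OF 2 1])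
  have g': "((\<lambda>t. if (sin t)\<^sup>2 = A\<^sup>2 then chart_excess A B R t else ?g t) has_integral R * w + - (2 * \<beta> * (pi + 1 / R))) {-\<beta>..\<beta>}"
    by (rule has_integral_spike_finite[OF finite_sin_square_eq[OF A] _ g]) auto
  have "R * w + - (2 * \<beta> * (pi + 1 / R))
    \<le> integral {-R..R} (\<lambda>u. zone_potential \<beta> (chart A B u) - zone_potential \<beta> A)"
  proof (rule has_integral_le[OF g' has_integral_chart_excess])
    fix t assume "t \<in> {-\<beta>..\<beta>}"
    show "(if (sin t)\<^sup>2 = A\<^sup>2 then chart_excess A B R t else ?g t) \<le> chart_excess A B R t"
    proof (cases "(sin t)\<^sup>2 = A\<^sup>2")
      case False
      then have ne: "A\<^sup>2 \<noteq> (sin t)\<^sup>2" by simp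
      show ?thesis
      proof (cases "t \<in> {p..p + w}")
        case True
        have "\<bar>A\<^sup>2 - (sin t)\<^sup>2\<bar> = \<bar>sin (p + t)\<bar> * \<bar>sin (p - t)\<bar>"
          using sin_add_times_sin_diff[of p t] p by (simp flip: abs_mult)
        also have "\<dots> \<le> 1 * \<bar>p - t\<bar>"
          by (intro mult_mono abs_sin_le_one abs_sin_x_le_abs_x) auto
        also have "\<dots> \<le> w" using True by auto
        finally have "2 * R * \<bar>A\<^sup>2 - (sin t)\<^sup>2\<bar> \<le> 2 * R * w"
          using assms(1) by (intro mult_left_mono) auto
        then have "2 * R * \<bar>A\<^sup>2 - (sin t)\<^sup>2\<bar> \<le> \<bar>A * B\<bar>" using w(3) by simp
        from chart_excess_ge(2)[OF assms(1) ne this] show ?thesis using True False by simp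
      qed (use chart_excess_ge(1)[OF assms(1) ne] False in auto)
    qed simp
  qed (use assms in auto)
  then show ?thesis using w by simp
qed

text \<open>The full range \<open>\<bar>t\<bar> \<le> pi / 2\<close> contributes 0, so it is enough to bound the complement of the zone
  from above; there the roots are real and at most \<open>C\<close> in absolute value.\<close>

lemma integral_zone_potential_chart_ge_central:
  assumes "0 < \<beta>" "\<beta> \<le> pi / 2" "A\<^sup>2 + B\<^sup>2 = 1" "\<bar>A\<bar> < sin \<beta>"
    and C: "C = 2 / ((sin \<beta>)\<^sup>2 - A\<^sup>2)" "C < R"
  shows "integral {-R..R} (\<lambda>u. zone_potential \<beta> (chart A B u) - zone_potential \<beta> A)
    \<ge> (pi - 2 * \<beta>) * (2 * arctan R - 2 * C\<^sup>2 / R)"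
proof -
  let ?E = "chart_excess A B R" and ?c = "2 * C\<^sup>2 / R - 2 * arctan R"
  have sb: "A\<^sup>2 < (sin \<beta>)\<^sup>2" using assms(4) power_strict_mono[of "\<bar>A\<bar>" "sin \<beta>" 2] by simp
  then have C0: "0 < C" "C * ((sin \<beta>)\<^sup>2 - A\<^sup>2) = 2"
    unfolding C(1) by (simp, metis diff_gt_0_iff_gt less_irrefl nonzero_divide_eq_eq)
  then have R: "0 < R" using C(2) by linarith
  have "A\<^sup>2 \<le> 1" using assms(3) by (smt (verit) zero_le_power2)
  then have A: "\<bar>A\<bar> \<le> 1" by (simp add: abs_square_le_1)
  have y: "\<bar>chart A B u\<bar> \<le> 1" for u by (rule abs_chart_le_one) (use assms in simp)
  note exc = has_integral_chart_excess[OF R _ eq_refl[OF assms(3)]]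
  have "zone_potential (pi / 2) (chart A B u) - zone_potential (pi / 2) A = 0" for u
    using zone_potential_half_pi[OF y, of u] zone_potential_half_pi[OF A] by simp
  then have full: "(?E has_integral 0) {-(pi/2)..pi/2}" using exc[of "pi / 2"] by simp
  have int: "?E integrable_on {a..b}" if "- (pi/2) \<le> a" "b \<le> pi/2" for a b
    by (rule integrable_subinterval_real[OF has_integral_integrable[OF full]]) (use that in auto)
  have le: "?E t \<le> ?c" if t: "\<bar>t\<bar> \<in> {\<beta>..pi/2}" for t
  proof -
    have "sin \<beta> \<le> sin \<bar>t\<bar>" using t assms by (intro sin_monotone_2pi_le) auto
    moreover have "0 \<le> sin \<beta>" using assms(4) by linarith
    ultimately have "(sin \<beta>)\<^sup>2 \<le> (sin \<bar>t\<bar>)\<^sup>2" by (intro power_mono)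
    then have s: "(sin \<beta>)\<^sup>2 \<le> (sin t)\<^sup>2" by (simp add: abs_if split: if_splits)
    have "2 \<le> C * ((sin t)\<^sup>2 - A\<^sup>2)"
      unfolding C0(2)[symmetric] using s C0(1) by (intro mult_left_mono) auto
    then show ?thesis using s sb by (intro chart_excess_le assms C(2)) auto
  qed
  have side: "integral {a..b} ?E \<le> (pi / 2 - \<beta>) * ?c"
    if ab: "b - a = pi / 2 - \<beta>" "\<And>t. t \<in> {a..b} \<Longrightarrow> \<bar>t\<bar> \<in> {\<beta>..pi/2}" for a b
  proof -
    have ab': "a \<le> b" using ab assms by auto
    have "\<bar>a\<bar> \<le> pi/2" "\<bar>b\<bar> \<le> pi/2" using ab(2)[of a] ab(2)[of b] ab' by auto
    then have "(?E has_integral integral {a..b} ?E) {a..b}" by (intro integrable_integral int) auto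
    moreover have "((\<lambda>t. ?c) has_integral (pi / 2 - \<beta>) * ?c) {a..b}"
      using has_integral_const_real[of ?c a b] ab' ab(1) by simp
    ultimately show ?thesis by (rule has_integral_le) (use le ab in auto)
  qed
  have "integral {-(pi/2)..-\<beta>} ?E + integral {-\<beta>..\<beta>} ?E + integral {\<beta>..pi/2} ?E = integral {-(pi/2)..pi/2} ?E"
  proof -
    have "integral {-(pi/2)..-\<beta>} ?E + integral {-\<beta>..\<beta>} ?E = integral {-(pi/2)..\<beta>} ?E"
      using assms by (intro Henstock_Kurzweil_Integration.integral_combine int) auto
    moreover have "integral {-(pi/2)..\<beta>} ?E + integral {\<beta>..pi/2} ?E = integral {-(pi/2)..pi/2} ?E"
      using assms by (intro Henstock_Kurzweil_Integration.integral_combine int) auto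
    ultimately show ?thesis by simp
  qed
  moreover have "integral {-(pi/2)..-\<beta>} ?E \<le> (pi / 2 - \<beta>) * ?c" "integral {\<beta>..pi/2} ?E \<le> (pi / 2 - \<beta>) * ?c"
    by (rule side; use assms(1,2) in auto)+
  ultimately have "integral {-\<beta>..\<beta>} ?E \<ge> - (2 * ((pi / 2 - \<beta>) * ?c))"
    using integral_unique[OF full] by linarith
  moreover have "integral {-\<beta>..\<beta>} ?E = integral {-R..R} (\<lambda>u. zone_potential \<beta> (chart A B u) - zone_potential \<beta> A)"
    using exc[of \<beta>] assms by (intro integral_unique) auto
  ultimately show ?thesis by (simp add: algebra_simps)
qed

section \<open>Maxima of the total potential\<close>

definition circle_point :: "'a::euclidean_space \<Rightarrow> 'a \<Rightarrow> real \<Rightarrow> 'a" where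
  "circle_point x e u = (1 / sqrt (1 + u\<^sup>2)) *\<^sub>R (u *\<^sub>R x + e)"

lemma inner_circle_point: "v \<bullet> circle_point x e u = chart (v \<bullet> x) (v \<bullet> e) u"
  by (simp add: circle_point_def chart_def inner_add_right mult.commute)

lemma norm_circle_point:
  assumes "norm x = 1" "norm e = 1" "x \<bullet> e = 0"
  shows "norm (circle_point x e u) = 1"
proof -
  have "(norm (u *\<^sub>R x + e))\<^sup>2 = u\<^sup>2 * (x \<bullet> x) + 2 * u * (x \<bullet> e) + e \<bullet> e"
    by (simp only: power2_norm_eq_inner)
      (simp add: inner_add_left inner_add_right inner_commute power2_eq_square algebra_simps)
  also have "\<dots> = 1 + u\<^sup>2" using assms by (simp add: dot_square_norm)
  finally have "norm (u *\<^sub>R x + e) = sqrt (1 + u\<^sup>2)" by (metis norm_ge_zero real_sqrt_unique)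
  then show ?thesis using one_plus_square_pos[of u] by (simp add: circle_point_def)
qed

lemma bessel_two:
  fixes v x e :: "'a::real_inner"
  assumes "norm x = 1" "norm e = 1" "x \<bullet> e = 0"
  shows "(norm v)\<^sup>2 = (v \<bullet> x)\<^sup>2 + (v \<bullet> e)\<^sup>2 + (norm (v - (v \<bullet> x) *\<^sub>R x - (v \<bullet> e) *\<^sub>R e))\<^sup>2"
  using assms unfolding power2_norm_eq_inner norm_eq_1
  by (simp add: inner_diff_left inner_diff_right inner_commute power2_eq_square algebra_simps)

text \<open>One Gram-Schmidt step: \<open>e\<close> is the tangent at \<open>x\<close> of the great
  circle through \<open>x\<close> and \<open>v\<close>.\<close>

lemma obtain_orthonormal_partner:
  fixes v x :: "'a::real_inner"
  assumes "norm v = 1" "norm x = 1" "\<bar>v \<bullet> x\<bar> < 1"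
  obtains e where "norm e = 1" "x \<bullet> e = 0" "v = (v \<bullet> x) *\<^sub>R x + (v \<bullet> e) *\<^sub>R e"
proof -
  define w where "w = v - (v \<bullet> x) *\<^sub>R x"
  have xw: "x \<bullet> w = 0" using assms(2) by (simp add: w_def inner_diff_right inner_commute norm_eq_1)
  have "w \<noteq> 0"
  proof
    assume "w = 0"
    then have "norm v = norm ((v \<bullet> x) *\<^sub>R x)" by (simp add: w_def)
    then show False using assms by simp
  qed
  define e where "e = (1 / norm w) *\<^sub>R w"
  have "v \<bullet> w = w \<bullet> w"
  proof -
    have "v \<bullet> w = (w + (v \<bullet> x) *\<^sub>R x) \<bullet> w" by (simp add: w_def)
    then show ?thesis using xw by (simp add: inner_add_left)
  qed
  then have "(v \<bullet> e) *\<^sub>R e = w"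
    using \<open>w \<noteq> 0\<close> by (simp add: e_def dot_square_norm power2_eq_square)
  then have "v = (v \<bullet> x) *\<^sub>R x + (v \<bullet> e) *\<^sub>R e" by (simp add: w_def)
  moreover have "norm e = 1" "x \<bullet> e = 0" using \<open>w \<noteq> 0\<close> xw by (auto simp: e_def)
  ultimately show ?thesis using that by blast
qed

text \<open>Only unit normals and half widths are fixed, without a covering condition, so that the
  results also apply to enlarged zones.\<close>

locale zone_system =
  fixes I :: "'i set" and v :: "'i \<Rightarrow> 'a::euclidean_space" and \<alpha> :: "'i \<Rightarrow> real"
  assumes finite_I: "finite I"
    and norm_v: "k \<in> I \<Longrightarrow> norm (v k) = 1"
    and \<alpha>_pos: "k \<in> I \<Longrightarrow> 0 < \<alpha> k"
    and \<alpha>_le: "k \<in> I \<Longrightarrow> \<alpha> k \<le> pi / 2"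
begin

definition pot :: "'a \<Rightarrow> real" where
  "pot x = (\<Sum>k\<in>I. zone_potential (\<alpha> k) (v k \<bullet> x))"

definition maximal :: "'a \<Rightarrow> bool" where
  "maximal x \<longleftrightarrow> norm x = 1 \<and> (\<forall>y. norm y = 1 \<longrightarrow> pot y \<le> pot x)"

lemma abs_inner_v_le: "k \<in> I \<Longrightarrow> norm x = 1 \<Longrightarrow> \<bar>v k \<bullet> x\<bar> \<le> 1"
  using Cauchy_Schwarz_ineq2[of "v k" x] by (simp add: norm_v)

lemma continuous_on_pot: "continuous_on (sphere 0 1) pot"
  unfolding pot_def
proof (intro continuous_on_sum)
  fix k assume k: "k \<in> I"
  show "continuous_on (sphere 0 1) (\<lambda>x. zone_potential (\<alpha> k) (v k \<bullet> x))"
    using abs_inner_v_le[OF k] \<alpha>_pos[OF k]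
    by (intro continuous_on_compose2[OF continuous_on_zone_potential] continuous_intros)
      (auto simp: abs_le_iff minus_le_iff)
qed

lemma maximal_exists: "\<exists>x. maximal x"
proof -
  have "\<exists>x\<in>sphere 0 1. \<forall>y\<in>sphere 0 1. pot y \<le> pot x"
    by (intro continuous_attains_sup continuous_on_pot) auto
  then show ?thesis by (auto simp: maximal_def)
qed

lemma continuous_on_circle_point: "continuous_on S (circle_point x e)"
  unfolding circle_point_def using one_plus_square_pos
  by (intro continuous_intros) (metis less_irrefl real_sqrt_eq_zero_cancel_iff)

lemma bessel_v:
  assumes "norm x = 1" "norm e = 1" "x \<bullet> e = 0" "k \<in> I"
  shows "(v k \<bullet> x)\<^sup>2 + (v k \<bullet> e)\<^sup>2 \<le> 1"
  using bessel_two[OF assms(1-3), of "v k"] norm_v[OF assms(4)] by (smt (verit) one_power2 zero_le_power2)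

lemma continuous_on_pot_circle_point:
  assumes "norm x = 1" "norm e = 1" "x \<bullet> e = 0"
  shows "continuous_on S (\<lambda>u. pot (circle_point x e u))"
  using norm_circle_point[OF assms]
  by (intro continuous_on_compose2[OF continuous_on_pot continuous_on_circle_point]) auto

text \<open>Adds up the contributions over \<open>{-R..R}\<close> and lets \<open>R\<close> tend to
  infinity. The defect is nonnegative by maximality, so the fixed window \<open>{-r..r}\<close> is
  bounded by every larger one. The parameter \<open>g\<close> collects gains beyond the general
  bound: zero for the inequality, positive at an overlap.\<close>

lemma integral_pot_defect_le_gain:
  assumes max: "maximal x" and e: "norm e = 1" "x \<bullet> e = 0"
    and i: "i \<in> I" "\<bar>v i \<bullet> x\<bar> < sin (\<alpha> i)" "v i = (v i \<bullet> x) *\<^sub>R x + (v i \<bullet> e) *\<^sub>R e"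
    and gain: "\<And>k. k \<in> I - {i} \<Longrightarrow> eventually (\<lambda>R.
       integral {-R..R} (\<lambda>u. zone_potential (\<alpha> k) (chart (v k \<bullet> x) (v k \<bullet> e) u) - zone_potential (\<alpha> k) (v k \<bullet> x))
        \<ge> g k - 2 * \<alpha> k * (pi + 1 / R)) at_top"
  shows "integral {-r..r} (\<lambda>u. pot x - pot (circle_point x e u))
     \<le> pi * ((\<Sum>k\<in>I. 2 * \<alpha> k) - pi) - (\<Sum>k\<in>I - {i}. g k)"
proof -
  have x: "norm x = 1" using max by (simp add: maximal_def)
  let ?D = "\<lambda>k R. integral {-R..R} (\<lambda>u. zone_potential (\<alpha> k) (chart (v k \<bullet> x) (v k \<bullet> e) u) - zone_potential (\<alpha> k) (v k \<bullet> x))"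
  let ?f = "\<lambda>u. pot x - pot (circle_point x e u)"
  have f: "?f integrable_on {a..b}" for a b
    by (intro integrable_continuous_interval continuous_intros continuous_on_pot_circle_point x e)
  have f0: "?f u \<ge> 0" for u using max norm_circle_point[OF x e] by (simp add: maximal_def)
  define C where "C = 2 / ((sin (\<alpha> i))\<^sup>2 - (v i \<bullet> x)\<^sup>2)"
  \<comment> \<open>The bound for finite \<open>R\<close>; its limit is the right side of the claim,
    since \<open>arctan R\<close> tends to \<open>pi / 2\<close>.\<close>
  define b where "b = (\<lambda>R. (\<Sum>k\<in>I - {i}. 2 * \<alpha> k * (pi + 1 / R) - g k)
      - (pi - 2 * \<alpha> i) * (2 * arctan R - 2 * C\<^sup>2 / R))"
  \<comment> \<open>The circle passes through the pole, so Bessel's inequality is an equality for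
    \<open>v i\<close>.\<close>
  have AB: "(v i \<bullet> x)\<^sup>2 + (v i \<bullet> e)\<^sup>2 = 1"
  proof -
    have "v i - (v i \<bullet> x) *\<^sub>R x - (v i \<bullet> e) *\<^sub>R e = 0" using i(3) by (metis add_diff_cancel_left' diff_self)
    then show ?thesis using bessel_two[OF x e, of "v i"] norm_v[OF i(1)] by simp
  qed
  have integrable: "(\<lambda>u. zone_potential (\<alpha> k) (chart (v k \<bullet> x) (v k \<bullet> e) u) - zone_potential (\<alpha> k) (v k \<bullet> x)) integrable_on {a..b}"
    if "k \<in> I" for k a b
    using abs_chart_le_one[OF bessel_v[OF x e that]] \<alpha>_pos[OF that]
    by (intro integrable_continuous_interval continuous_on_diff continuous_on_const
        continuous_on_compose2[OF continuous_on_zone_potential continuous_on_chart])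
      (auto simp: abs_le_iff minus_le_iff)
  have "eventually (\<lambda>R. \<forall>k\<in>I - {i}. ?D k R \<ge> g k - 2 * \<alpha> k * (pi + 1 / R)) at_top"
    using gain finite_I by (intro eventually_ball_finite) auto
  then have ev: "eventually (\<lambda>R. integral {-r..r} ?f \<le> b R) at_top"
    using eventually_gt_at_top[of C] eventually_ge_at_top[of r]
  proof eventually_elim
    case (elim R)
    have "integral {-r..r} ?f \<le> integral {-R..R} ?f"
      using elim(3) f0 by (intro integral_subset_le f) auto
    also have "\<dots> = integral {-R..R} (\<lambda>u. - (\<Sum>k\<in>I. zone_potential (\<alpha> k) (chart (v k \<bullet> x) (v k \<bullet> e) u) - zone_potential (\<alpha> k) (v k \<bullet> x)))"
      by (simp add: inner_circle_point pot_def sum_subtractf)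
    also have "\<dots> = - (\<Sum>k\<in>I. ?D k R)"
      using finite_I integrable by (simp add: integral_neg integral_sum del: integral_diff)
    also have "(\<Sum>k\<in>I. ?D k R) = ?D i R + (\<Sum>k\<in>I - {i}. ?D k R)"
      using finite_I i(1) by (rule sum.remove)
    also have "- \<dots> \<le> - ((pi - 2 * \<alpha> i) * (2 * arctan R - 2 * C\<^sup>2 / R)
        + (\<Sum>k\<in>I - {i}. g k - 2 * \<alpha> k * (pi + 1 / R)))"
    proof (intro le_imp_neg_le add_mono sum_mono)
      show "(pi - 2 * \<alpha> i) * (2 * arctan R - 2 * C\<^sup>2 / R) \<le> ?D i R"
        by (rule integral_zone_potential_chart_ge_central[OF \<alpha>_pos[OF i(1)] \<alpha>_le[OF i(1)] AB i(2) C_def elim(2)])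
    qed (use elim(1) in auto)
    also have "\<dots> = b R"
      by (simp add: b_def sum_negf[symmetric] del: sum_negf)
    finally show ?case .
  qed
  have lim: "(b \<longlongrightarrow> (\<Sum>k\<in>I - {i}. 2 * \<alpha> k * (pi + 0) - g k) - (pi - 2 * \<alpha> i) * (2 * (pi / 2) - 0)) at_top"
  proof -
    have "((\<lambda>R::real. 1 / R) \<longlongrightarrow> 0) at_top" "((\<lambda>R::real. 2 * C\<^sup>2 / R) \<longlongrightarrow> 0) at_top"
      by (rule tendsto_divide_0[OF tendsto_const], simp add: filterlim_at_top_imp_at_infinity filterlim_ident)+
    then show ?thesis unfolding b_def by (intro tendsto_intros tendsto_arctan_at_top)
  qed
  have "integral {-r..r} ?f \<le> (\<Sum>k\<in>I - {i}. 2 * \<alpha> k * (pi + 0) - g k) - (pi - 2 * \<alpha> i) * (2 * (pi / 2) - 0)"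
    by (rule tendsto_lowerbound[OF lim ev]) simp
  also have "\<dots> = pi * ((\<Sum>k\<in>I. 2 * \<alpha> k) - pi) - (\<Sum>k\<in>I - {i}. g k)"
    using sum.remove[OF finite_I i(1), of "\<lambda>k. 2 * \<alpha> k"]
    by (simp add: sum_subtractf sum_distrib_left sum_distrib_right algebra_simps)
  finally show ?thesis .
qed

lemma eventually_integral_zone_potential_ge:
  assumes "norm x = 1" "norm e = 1" "x \<bullet> e = 0" "k \<in> I"
  shows "eventually (\<lambda>R.
       integral {-R..R} (\<lambda>u. zone_potential (\<alpha> k) (chart (v k \<bullet> x) (v k \<bullet> e) u) - zone_potential (\<alpha> k) (v k \<bullet> x))
        \<ge> 0 - 2 * \<alpha> k * (pi + 1 / R)) at_top"
  using eventually_gt_at_top[of 0]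
proof eventually_elim
  case (elim R)
  then show ?case
    using integral_zone_potential_chart_ge[OF elim _ bessel_v[OF assms]] \<alpha>_pos[OF assms(4)] by simp
qed

lemma eventually_integral_zone_potential_ge_inside:
  assumes "norm x = 1" "norm e = 1" "x \<bullet> e = 0" "k \<in> I" "\<bar>v k \<bullet> x\<bar> < sin (\<alpha> k)"
  shows "eventually (\<lambda>R.
       integral {-R..R} (\<lambda>u. zone_potential (\<alpha> k) (chart (v k \<bullet> x) (v k \<bullet> e) u) - zone_potential (\<alpha> k) (v k \<bullet> x))
        \<ge> \<bar>(v k \<bullet> x) * (v k \<bullet> e)\<bar> / 2 - 2 * \<alpha> k * (pi + 1 / R)) at_top"
proof -
  define w where "w = \<alpha> k - arcsin \<bar>v k \<bullet> x\<bar>"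
  have a: "0 < \<alpha> k" "\<alpha> k \<le> pi / 2" using \<alpha>_pos \<alpha>_le assms(4) by auto
  have "arcsin \<bar>v k \<bullet> x\<bar> < arcsin (sin (\<alpha> k))"
    using assms(5) by (intro arcsin_less_arcsin) auto
  then have "w > 0" using a by (simp add: w_def arcsin_sin)
  show ?thesis
    using eventually_gt_at_top[of 0] eventually_ge_at_top[of "\<bar>(v k \<bullet> x) * (v k \<bullet> e)\<bar> / (2 * w)"]
  proof eventually_elim
    case (elim R)
    have "\<bar>(v k \<bullet> x) * (v k \<bullet> e)\<bar> \<le> 2 * R * w"
      using elim \<open>w > 0\<close> by (simp add: field_simps)
    then show ?case
      unfolding w_def
      by (intro integral_zone_potential_chart_ge_inside[OF elim(1) a bessel_v[OF assms(1-4)] assms(5)])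
  qed
qed

lemma integral_pot_defect_le:
  assumes "maximal x" "norm e = 1" "x \<bullet> e = 0"
    "i \<in> I" "\<bar>v i \<bullet> x\<bar> < sin (\<alpha> i)" "v i = (v i \<bullet> x) *\<^sub>R x + (v i \<bullet> e) *\<^sub>R e"
  shows "integral {-r..r} (\<lambda>u. pot x - pot (circle_point x e u)) \<le> pi * ((\<Sum>k\<in>I. 2 * \<alpha> k) - pi)"
  using integral_pot_defect_le_gain[OF assms, of "\<lambda>_. 0" r] eventually_integral_zone_potential_ge assms
  by (simp add: maximal_def)

lemma integral_pot_defect_le_overlap:
  assumes "maximal x" "norm e = 1" "x \<bullet> e = 0"
    "i \<in> I" "\<bar>v i \<bullet> x\<bar> < sin (\<alpha> i)" "v i = (v i \<bullet> x) *\<^sub>R x + (v i \<bullet> e) *\<^sub>R e"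
    "j \<in> I" "j \<noteq> i" "\<bar>v j \<bullet> x\<bar> < sin (\<alpha> j)"
  shows "integral {-r..r} (\<lambda>u. pot x - pot (circle_point x e u))
    \<le> pi * ((\<Sum>k\<in>I. 2 * \<alpha> k) - pi) - \<bar>(v j \<bullet> x) * (v j \<bullet> e)\<bar> / 2"
proof -
  have x: "norm x = 1" using assms(1) by (simp add: maximal_def)
  let ?g = "\<lambda>k. if k = j then \<bar>(v j \<bullet> x) * (v j \<bullet> e)\<bar> / 2 else 0"
  have "integral {-r..r} (\<lambda>u. pot x - pot (circle_point x e u))
    \<le> pi * ((\<Sum>k\<in>I. 2 * \<alpha> k) - pi) - (\<Sum>k\<in>I - {i}. ?g k)"
  proof (rule integral_pot_defect_le_gain[OF assms(1-6)])
    fix k assume k: "k \<in> I - {i}"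
    show "eventually (\<lambda>R.
       integral {-R..R} (\<lambda>u. zone_potential (\<alpha> k) (chart (v k \<bullet> x) (v k \<bullet> e) u) - zone_potential (\<alpha> k) (v k \<bullet> x))
        \<ge> ?g k - 2 * \<alpha> k * (pi + 1 / R)) at_top"
      using k eventually_integral_zone_potential_ge[OF x assms(2,3), of k]
        eventually_integral_zone_potential_ge_inside[OF x assms(2,3,7,9)]
      by (cases "k = j") auto
  qed
  also have "(\<Sum>k\<in>I - {i}. ?g k) = \<bar>(v j \<bullet> x) * (v j \<bullet> e)\<bar> / 2"
    using finite_I assms(7,8) by (simp add: sum.delta)
  finally show ?thesis .
qed

lemma integral_pot_defect_nonneg:
  assumes "maximal x" "norm e = 1" "x \<bullet> e = 0"
  shows "0 \<le> integral {-r..r} (\<lambda>u. pot x - pot (circle_point x e u))"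
  using assms by (intro integral_nonneg integrable_continuous_interval continuous_intros
      continuous_on_pot_circle_point) (auto simp: maximal_def norm_circle_point)

end

section \<open>The lower bound for the total width of a cover\<close>

text \<open>If the total were below \<open>pi\<close>, all half widths could be enlarged with the
  total staying below \<open>pi\<close>. A maximum for the enlarged zones lies in an original closed
  zone, hence strictly inside an enlarged one, and the bound on the nonnegative defect becomes
  negative.\<close>

lemma zone_cover_sum_ge_pi:
  fixes v :: "'i \<Rightarrow> 'a::euclidean_space" and \<alpha> :: "'i \<Rightarrow> real"
  assumes "finite I" "\<And>k. k \<in> I \<Longrightarrow> norm (v k) = 1" "\<And>k. k \<in> I \<Longrightarrow> 0 < \<alpha> k"
    and cover: "\<And>x. norm x = 1 \<Longrightarrow> \<exists>k\<in>I. \<bar>v k \<bullet> x\<bar> \<le> sin (\<alpha> k)"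
  shows "pi \<le> (\<Sum>k\<in>I. 2 * \<alpha> k)"
proof (rule ccontr)
  assume "\<not> ?thesis"
  then have less: "(\<Sum>k\<in>I. 2 * \<alpha> k) < pi" by simp
  \<comment> \<open>The total width grows by \<open>2 * card I * \<epsilon>\<close>, less than half
    of the deficit.\<close>
  define \<epsilon> where "\<epsilon> = (pi - (\<Sum>k\<in>I. 2 * \<alpha> k)) / (4 * (real (card I) + 1))"
  have \<epsilon>: "0 < \<epsilon>" using less by (simp add: \<epsilon>_def)
  define \<beta> where "\<beta> = (\<lambda>k. \<alpha> k + \<epsilon>)"
  have "(\<Sum>k\<in>I. 2 * \<beta> k) = (\<Sum>k\<in>I. 2 * \<alpha> k) + 2 * (real (card I) * \<epsilon>)"
    by (simp add: \<beta>_def sum.distrib distrib_left)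
  moreover have "4 * (real (card I) * \<epsilon>) + 4 * \<epsilon> = pi - (\<Sum>k\<in>I. 2 * \<alpha> k)"
  proof -
    have "4 * (real (card I) * \<epsilon>) + 4 * \<epsilon> = 4 * (real (card I) + 1) * \<epsilon>" by (simp add: algebra_simps)
    also have "\<dots> = pi - (\<Sum>k\<in>I. 2 * \<alpha> k)" by (simp add: \<epsilon>_def)
    finally show ?thesis .
  qed
  moreover have "0 \<le> real (card I) * \<epsilon>" using \<epsilon> by simp
  ultimately have sum: "(\<Sum>k\<in>I. 2 * \<beta> k) < pi" using \<epsilon> by linarith
  have pos: "0 < \<beta> k" if "k \<in> I" for k
    using assms(3)[OF that] \<epsilon> by (simp add: \<beta>_def)
  have \<beta>: "0 < \<beta> k" "\<beta> k \<le> pi / 2" if "k \<in> I" for k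
  proof -
    have "2 * \<beta> k \<le> (\<Sum>k\<in>I. 2 * \<beta> k)"
      using that assms(1) by (intro member_le_sum) (auto dest: pos)
    with sum show "\<beta> k \<le> pi / 2" by linarith
  qed (rule pos[OF that])
  interpret zone_system I v \<beta> by unfold_locales (use assms \<beta> in auto)
  obtain x where x: "maximal x" using maximal_exists by blast
  then have nx: "norm x = 1" by (simp add: maximal_def)
  obtain i where i: "i \<in> I" "\<bar>v i \<bullet> x\<bar> \<le> sin (\<alpha> i)" using cover[OF nx] by blast
  have "sin (\<alpha> i) < sin (\<beta> i)"
    using \<beta>[OF i(1)] assms(3)[OF i(1)] \<epsilon> by (intro sin_monotone_2pi) (auto simp: \<beta>_def)
  then have inside: "\<bar>v i \<bullet> x\<bar> < sin (\<beta> i)" using i by simp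
  then have "\<bar>v i \<bullet> x\<bar> < 1" using sin_le_one[of "\<beta> i"] by linarith
  then obtain e where e: "norm e = 1" "x \<bullet> e = 0" "v i = (v i \<bullet> x) *\<^sub>R x + (v i \<bullet> e) *\<^sub>R e"
    using obtain_orthonormal_partner[OF norm_v[OF i(1)] nx] by blast
  have "0 \<le> pi * ((\<Sum>k\<in>I. 2 * \<beta> k) - pi)"
    using integral_pot_defect_nonneg[OF x e(1,2), of 1] integral_pot_defect_le[OF x e(1,2) i(1) inside e(3), of 1]
    by linarith
  then show False using sum mult_pos_neg[OF pi_gt_zero, of "(\<Sum>k\<in>I. 2 * \<beta> k) - pi"] by linarith
qed

section \<open>Equality case: a great circle of maxima without overlaps\<close>

lemma orthonormal_pair_expansion:
  fixes v x e :: "'a::real_inner"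
  assumes "norm x = 1" "norm e = 1" "x \<bullet> e = 0"
  shows "v = (v \<bullet> x) *\<^sub>R x + (v \<bullet> e) *\<^sub>R e \<longleftrightarrow> (v \<bullet> x)\<^sup>2 + (v \<bullet> e)\<^sup>2 = (norm v)\<^sup>2"
proof -
  have *: "w = 0 \<longleftrightarrow> S = N" if "N = S + (norm w)\<^sup>2" for w :: 'a and S N :: real
    using that by auto
  show ?thesis
    by (rule *[OF bessel_two[OF assms, of v], unfolded diff_diff_eq right_minus_eq])
qed

text \<open>The strict bound on the half widths excludes a single zone equal to the whole sphere,
  which is treated apart, and leaves room to enlarge every zone.\<close>

locale tight_zone_cover = zone_system I v \<alpha>
  for I :: "'i set" and v :: "'i \<Rightarrow> 'a::euclidean_space" and \<alpha> +
  assumes \<alpha>_less: "k \<in> I \<Longrightarrow> \<alpha> k < pi / 2"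
    and cover: "norm x = 1 \<Longrightarrow> \<exists>k\<in>I. \<bar>v k \<bullet> x\<bar> \<le> sin (\<alpha> k)"
    and sum_\<alpha>: "(\<Sum>k\<in>I. 2 * \<alpha> k) = pi"
begin

lemma sin_\<alpha>: "k \<in> I \<Longrightarrow> 0 < sin (\<alpha> k)" "k \<in> I \<Longrightarrow> sin (\<alpha> k) < 1"
  using \<alpha>_pos[of k] \<alpha>_less[of k] sin_monotone_2pi[of "\<alpha> k" "pi / 2"] sin_gt_zero[of "\<alpha> k"] by auto

text \<open>A continuous nonnegative function with nonpositive integral vanishes. The maximum
  \<open>y\<close> is independent of the arc, so that the base point \<open>x\<close> of the chart
  may be any unit vector.\<close>

lemma maximal_circle_point_if_integral:
  assumes "norm x = 1" "norm e = 1" "x \<bullet> e = 0" "maximal y"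
    and "integral {-r..r} (\<lambda>u. pot y - pot (circle_point x e u)) \<le> 0" "\<bar>u\<bar> \<le> r"  "0 < r"
  shows "maximal (circle_point x e u)"
proof -
  let ?f = "\<lambda>u. pot y - pot (circle_point x e u)"
  have c: "continuous_on {-r..r} ?f"
    by (intro continuous_intros continuous_on_pot_circle_point assms)
  have f0: "?f u \<ge> 0" for u using assms norm_circle_point[OF assms(1-3)] by (simp add: maximal_def)
  have "0 \<le> integral {-r..r} ?f"
    by (rule integral_nonneg[OF integrable_continuous_interval[OF c]]) (rule f0)
  then have "integral {-r..r} ?f = 0" using assms(5) by linarith
  then have "?f u = 0"
    using integral_eq_0_iff[OF c _ f0] assms(6,7) by (auto simp: abs_le_iff)
  then show ?thesis
    using assms(4) norm_circle_point[OF assms(1-3)] by (simp add: maximal_def)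
qed

text \<open>With total width \<open>pi\<close> the bound on the defect is 0 on every window; the one
  of radius \<open>\<bar>u\<bar> + 1\<close> contains \<open>u\<close>.\<close>

lemma maximal_circle_point:
  assumes "maximal x" "norm e = 1" "x \<bullet> e = 0"
    "i \<in> I" "\<bar>v i \<bullet> x\<bar> < sin (\<alpha> i)" "v i = (v i \<bullet> x) *\<^sub>R x + (v i \<bullet> e) *\<^sub>R e"
  shows "maximal (circle_point x e u)"
proof (rule maximal_circle_point_if_integral[of x e x "\<bar>u\<bar> + 1"])
  show "integral {- (\<bar>u\<bar> + 1)..\<bar>u\<bar> + 1} (\<lambda>u. pot x - pot (circle_point x e u)) \<le> 0"
    using integral_pot_defect_le[OF assms, of "\<bar>u\<bar> + 1"] sum_\<alpha> by simp
qed (use assms in \<open>auto simp: maximal_def\<close>)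

text \<open>The overlap gain makes \<open>(v j \<bullet> y) (v j \<bullet> e')\<close> vanish at every nearby point \<open>y\<close> of the circle with tangent
  \<open>e'\<close>; its numerator in the chart is a quadratic polynomial in \<open>u\<close>, which must therefore be zero.\<close>

lemma inner_eq_0_of_overlap:
  assumes x: "maximal x" and ij: "i \<in> I" "j \<in> I" "j \<noteq> i"
    and inside: "\<bar>v i \<bullet> x\<bar> < sin (\<alpha> i)" "\<bar>v j \<bullet> x\<bar> < sin (\<alpha> j)"
    and e: "norm e = 1" "x \<bullet> e = 0" "v i = (v i \<bullet> x) *\<^sub>R x + (v i \<bullet> e) *\<^sub>R e"
  shows "eventually (\<lambda>u. maximal (circle_point x e u) \<and>
      \<bar>v i \<bullet> circle_point x e u\<bar> < sin (\<alpha> i) \<and> \<bar>v j \<bullet> circle_point x e u\<bar> < sin (\<alpha> j)) at_top"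
    and "v j \<bullet> x = 0"
proof -
  have nx: "norm x = 1" using x by (simp add: maximal_def)
  \<comment> \<open>The base point \<open>x\<close> is the limit of the chart at infinity, so strict
    inequalities at \<open>x\<close> persist for large \<open>u\<close>.\<close>
  have lim: "((\<lambda>u. \<bar>w \<bullet> circle_point x e u\<bar>) \<longlongrightarrow> \<bar>w \<bullet> x\<bar>) at_top" for w
  proof -
    have "((\<lambda>u::real. u / sqrt (1 + u\<^sup>2)) \<longlongrightarrow> 1) at_top" "((\<lambda>u::real. 1 / sqrt (1 + u\<^sup>2)) \<longlongrightarrow> 0) at_top"
      by real_asymp+
    then have "((\<lambda>u. (w \<bullet> x) * (u / sqrt (1 + u\<^sup>2)) + (w \<bullet> e) * (1 / sqrt (1 + u\<^sup>2))) \<longlongrightarrow> (w \<bullet> x) * 1 + (w \<bullet> e) * 0) at_top"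
      by (intro tendsto_intros)
    then have "((\<lambda>u. w \<bullet> circle_point x e u) \<longlongrightarrow> w \<bullet> x) at_top"
      by (simp add: inner_circle_point chart_def add_divide_distrib)
    then show ?thesis by (rule tendsto_rabs)
  qed
  show ev: "eventually (\<lambda>u. maximal (circle_point x e u) \<and>
      \<bar>v i \<bullet> circle_point x e u\<bar> < sin (\<alpha> i) \<and> \<bar>v j \<bullet> circle_point x e u\<bar> < sin (\<alpha> j)) at_top"
    using order_tendstoD(2)[OF lim inside(1)] order_tendstoD(2)[OF lim inside(2)]
    by eventually_elim (use maximal_circle_point[OF x e(1,2) ij(1) inside(1) e(3)] in auto)
  let ?A = "v j \<bullet> x" and ?B = "v j \<bullet> e"
  have "eventually (\<lambda>u. (?A * u + ?B) * (?A - ?B * u) = 0) at_top"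
    using ev
  proof eventually_elim
    case (elim u)
    \<comment> \<open>\<open>?f\<close> is a unit tangent of the same great circle at
      \<open>?y\<close>; the overlap estimate is applied with \<open>?y\<close> as new base
      point.\<close>
    let ?y = "circle_point x e u" and ?f = "circle_point (- e) x u"
    have s: "sqrt (1 + u\<^sup>2) * sqrt (1 + u\<^sup>2) = 1 + u\<^sup>2" "1 + u\<^sup>2 \<noteq> 0"
      using one_plus_square_pos[of u] by auto
    have f: "norm ?f = 1" using norm_circle_point[of "-e" x u] nx e by (simp add: inner_commute)
    have y: "norm ?y = 1" using norm_circle_point[OF nx e(1,2)] .
    have yf: "?y \<bullet> ?f = 0"
    proof -
      have "x \<bullet> x = 1" "e \<bullet> e = 1" "e \<bullet> x = 0"
        using nx e(1,2) by (auto simp: norm_eq_1 inner_commute)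
      then have "(u *\<^sub>R x + e) \<bullet> (u *\<^sub>R (- e) + x) = 0"
        using e(2) by (simp only: inner_add_left inner_add_right inner_scaleR_left inner_scaleR_right inner_minus_right) simp
      then show ?thesis by (simp add: circle_point_def)
    qed
    have "(v i \<bullet> ?y)\<^sup>2 + (v i \<bullet> ?f)\<^sup>2 = ((v i \<bullet> x) * u + (v i \<bullet> e))\<^sup>2 / (1 + u\<^sup>2) + (- (v i \<bullet> e) * u + (v i \<bullet> x))\<^sup>2 / (1 + u\<^sup>2)"
      by (simp add: inner_circle_point chart_square)
    also have "\<dots> = ((v i \<bullet> x)\<^sup>2 + (v i \<bullet> e)\<^sup>2) * (1 + u\<^sup>2) / (1 + u\<^sup>2)"
      by (simp add: power2_eq_square algebra_simps flip: add_divide_distrib)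
    also have "\<dots> = (norm (v i))\<^sup>2"
      using e(3) orthonormal_pair_expansion[OF nx e(1,2), of "v i"] s by simp
    finally have vi: "v i = (v i \<bullet> ?y) *\<^sub>R ?y + (v i \<bullet> ?f) *\<^sub>R ?f"
      using orthonormal_pair_expansion[OF y f yf] by blast
    have "integral {-1..1} (\<lambda>u. pot ?y - pot (circle_point ?y ?f u)) \<le> - \<bar>(v j \<bullet> ?y) * (v j \<bullet> ?f)\<bar> / 2"
      using integral_pot_defect_le_overlap[of ?y ?f i j 1] elim f yf vi ij sum_\<alpha> by simp
    moreover have "0 \<le> integral {-1..1} (\<lambda>u. pot ?y - pot (circle_point ?y ?f u))"
      using elim f yf by (intro integral_pot_defect_nonneg) auto
    ultimately have "\<bar>(v j \<bullet> ?y) * (v j \<bullet> ?f)\<bar> \<le> 0" by linarith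
    then have "(v j \<bullet> ?y) * (v j \<bullet> ?f) = 0" by simp
    then have "chart ?A ?B u * chart (- ?B) ?A u = 0" by (simp add: inner_circle_point)
    then show ?case using s by (auto simp: chart_def)
  qed
  then obtain N where N: "\<And>u. u \<ge> N \<Longrightarrow> (?A * u + ?B) * (?A - ?B * u) = 0"
    by (auto simp: eventually_at_top_linorder)
  have "{N..} \<subseteq> {u. poly [:?A * ?B, ?A\<^sup>2 - ?B\<^sup>2, - (?A * ?B):] u = 0}"
    using N by (auto simp: power2_eq_square algebra_simps)
  then have "infinite {u. poly [:?A * ?B, ?A\<^sup>2 - ?B\<^sup>2, - (?A * ?B):] u = 0}"
    using infinite_Ici finite_subset by blast
  then have "[:?A * ?B, ?A\<^sup>2 - ?B\<^sup>2, - (?A * ?B):] = 0" using poly_roots_finite by blast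
  \<comment> \<open>The coefficients give \<open>?A * ?B = 0\<close> and equal squares of
    \<open>?A\<close> and \<open>?B\<close>, hence both vanish.\<close>
  then show "v j \<bullet> x = 0" by auto
qed

text \<open>At every maximum interior to both zones, \<open>v i\<close> is orthogonal to the point.
  An overlap at \<open>x\<close> persists at another point of the circle through \<open>x\<close>
  and \<open>v i\<close>; being orthogonal to both points of its own plane, \<open>v i\<close> would
  be 0.\<close>

lemma no_overlap:
  assumes "maximal x" "i \<in> I" "j \<in> I" "\<bar>v i \<bullet> x\<bar> < sin (\<alpha> i)" "\<bar>v j \<bullet> x\<bar> < sin (\<alpha> j)"
  shows "i = j"
proof (rule ccontr)
  assume ne: "i \<noteq> j"
  have partner: "\<exists>e. norm e = 1 \<and> y \<bullet> e = 0 \<and> v k = (v k \<bullet> y) *\<^sub>R y + (v k \<bullet> e) *\<^sub>R e"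
    if "maximal y" "k \<in> I" "\<bar>v k \<bullet> y\<bar> < sin (\<alpha> k)" for y k
    using that obtain_orthonormal_partner[OF norm_v[of k], of y] sin_le_one[of "\<alpha> k"]
    unfolding maximal_def by (metis less_le_trans)
  \<comment> \<open>The preceding lemma with the roles of \<open>i\<close> and \<open>j\<close>
    exchanged.\<close>
  have zero: "v i \<bullet> y = 0" if "maximal y" "\<bar>v i \<bullet> y\<bar> < sin (\<alpha> i)" "\<bar>v j \<bullet> y\<bar> < sin (\<alpha> j)" for y
    using partner[OF that(1) assms(3) that(3)] inner_eq_0_of_overlap(2)[OF that(1) assms(3,2) ne that(3,2)] by blast
  obtain e where e: "norm e = 1" "x \<bullet> e = 0" "v i = (v i \<bullet> x) *\<^sub>R x + (v i \<bullet> e) *\<^sub>R e"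
    using partner assms by blast
  obtain u where "maximal (circle_point x e u)" "\<bar>v i \<bullet> circle_point x e u\<bar> < sin (\<alpha> i)"
      "\<bar>v j \<bullet> circle_point x e u\<bar> < sin (\<alpha> j)"
    using eventually_happens[OF inner_eq_0_of_overlap(1)[OF assms(1-3) ne[symmetric] assms(4,5) e]] by auto
  then have "v i \<bullet> circle_point x e u = 0" by (rule zero)
  moreover have "v i \<bullet> x = 0" using assms by (intro zero) auto
  ultimately have "v i \<bullet> e = 0"
    using one_plus_square_pos[of u] by (simp add: inner_circle_point chart_def)
  with \<open>v i \<bullet> x = 0\<close> e(3) have "v i = 0" by simp
  then show False using norm_v[OF assms(2)] by simp
qed

end

lemma continuous_on_circle_point_triple:
  "continuous_on S (\<lambda>(p, u). circle_point (fst p) (snd p) u)"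
  unfolding circle_point_def case_prod_unfold using one_plus_square_pos
  by (intro continuous_intros) (metis less_irrefl real_sqrt_eq_zero_cancel_iff)

text \<open>A great circle meets the boundary of a zone in finitely many points: they are roots of a
  quadratic, whose coefficients could all vanish only for \<open>s = 0\<close>.\<close>

lemma finite_abs_chart_eq:
  assumes "s \<noteq> 0"
  shows "finite {u. \<bar>chart A B u\<bar> = \<bar>s\<bar>}"
proof -
  have "A\<^sup>2 - s\<^sup>2 = 0 \<Longrightarrow> B\<^sup>2 - s\<^sup>2 = 0 \<Longrightarrow> 2 * A * B = 0 \<Longrightarrow> False"
    using assms by auto
  then have "[:B\<^sup>2 - s\<^sup>2, 2 * A * B, A\<^sup>2 - s\<^sup>2:] \<noteq> 0" by auto
  then have "finite {u. poly [:B\<^sup>2 - s\<^sup>2, 2 * A * B, A\<^sup>2 - s\<^sup>2:] u = 0}" by (rule poly_roots_finite)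
  moreover have "{u. \<bar>chart A B u\<bar> = \<bar>s\<bar>} \<subseteq> {u. poly [:B\<^sup>2 - s\<^sup>2, 2 * A * B, A\<^sup>2 - s\<^sup>2:] u = 0}"
  proof
    fix u assume "u \<in> {u. \<bar>chart A B u\<bar> = \<bar>s\<bar>}"
    then have "\<bar>chart A B u\<bar> = \<bar>s\<bar>" by simp
    from arg_cong[OF this, of "\<lambda>z. z\<^sup>2"] have "(chart A B u)\<^sup>2 = s\<^sup>2" by simp
    then have "(A * u + B)\<^sup>2 = s\<^sup>2 * (1 + u\<^sup>2)"
      using one_plus_square_pos[of u] by (simp add: chart_square divide_eq_eq)
    moreover have "poly [:B\<^sup>2 - s\<^sup>2, 2 * A * B, A\<^sup>2 - s\<^sup>2:] u = (A * u + B)\<^sup>2 - s\<^sup>2 * (1 + u\<^sup>2)"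
      by (simp add: power2_eq_square algebra_simps)
    ultimately show "u \<in> {u. poly [:B\<^sup>2 - s\<^sup>2, 2 * A * B, A\<^sup>2 - s\<^sup>2:] u = 0}" by simp
  qed
  ultimately show ?thesis by (rule finite_subset[rotated])
qed

context tight_zone_cover
begin

lemma nonempty_I: "I \<noteq> {}"
  using sum_\<alpha> by auto

lemma enlarged_zone_system:
  obtains \<delta>0 where "0 < \<delta>0" "\<And>\<delta>. 0 < \<delta> \<Longrightarrow> \<delta> \<le> \<delta>0 \<Longrightarrow> zone_system I v (\<lambda>k. \<alpha> k + \<delta>)"
proof -
  define \<delta>0 where "\<delta>0 = Min ((\<lambda>k. pi / 2 - \<alpha> k) ` I)"
  have "0 < \<delta>0" using finite_I nonempty_I \<alpha>_less by (simp add: \<delta>0_def)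
  moreover have "zone_system I v (\<lambda>k. \<alpha> k + \<delta>)" if d: "0 < \<delta>" "\<delta> \<le> \<delta>0" for \<delta>
  proof
    fix k assume k: "k \<in> I"
    have "\<delta>0 \<le> pi / 2 - \<alpha> k" using k finite_I by (simp add: \<delta>0_def)
    then show "\<alpha> k + \<delta> \<le> pi / 2" using d by linarith
    show "0 < \<alpha> k + \<delta>" using \<alpha>_pos[OF k] d by simp
  qed (use finite_I norm_v in auto)
  ultimately show ?thesis using that by blast
qed

text \<open>Maxima for slightly enlarged zones are interior to a zone, which is not known for \<open>\<alpha>\<close> itself.\<close>

lemma approximately_maximal_arc:
  assumes y: "maximal y" and \<eta>: "0 < \<eta>"
  shows "\<exists>x e. norm x = 1 \<and> norm e = 1 \<and> x \<bullet> e = 0 \<and>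
    integral {-1..1} (\<lambda>u. pot y - pot (circle_point x e u)) \<le> \<eta>"
proof -
  define c where "c = real (card I)"
  have c: "0 < c" using finite_I nonempty_I by (simp add: c_def card_gt_0_iff)
  obtain \<delta>0 where \<delta>0: "0 < \<delta>0" "\<And>\<delta>. 0 < \<delta> \<Longrightarrow> \<delta> \<le> \<delta>0 \<Longrightarrow> zone_system I v (\<lambda>k. \<alpha> k + \<delta>)"
    using enlarged_zone_system by blast
  obtain \<delta>1 where \<delta>1: "0 < \<delta>1"
    "\<And>y \<beta> \<beta>'. \<lbrakk>\<bar>y\<bar> \<le> 1; 0 \<le> \<beta>; \<beta> \<le> pi/2; 0 \<le> \<beta>'; \<beta>' \<le> pi/2; \<bar>\<beta> - \<beta>'\<bar> < \<delta>1\<rbrakk>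
      \<Longrightarrow> \<bar>zone_potential \<beta> y - zone_potential \<beta>' y\<bar> < \<eta> / (8 * c)"
    using zone_potential_uniformly_close[of "\<eta> / (8 * c)"] \<eta> c by auto
  \<comment> \<open>The three bounds keep the enlarged half widths admissible, make the two
    potentials differ by at most \<open>\<eta> / 8\<close>, and limit the defect caused by the extra
    width to \<open>\<eta> / 2\<close>. The potential error enters twice and is integrated over
    length 2, which accounts for the other \<open>\<eta> / 2\<close>.\<close>
  define \<delta> where "\<delta> = min (min \<delta>0 (\<delta>1 / 2)) (\<eta> / (4 * pi * c))"
  have \<delta>: "0 < \<delta>" "\<delta> \<le> \<delta>0" "\<delta> < \<delta>1" using \<delta>0(1) \<delta>1(1) \<eta> c by (auto simp: \<delta>_def)
  have \<delta>c: "pi * (2 * c * \<delta>) \<le> \<eta> / 2"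
  proof -
    have "\<delta> \<le> \<eta> / (4 * pi * c)" by (simp add: \<delta>_def)
    then have "\<delta> * (4 * pi * c) \<le> \<eta>" using c by (simp add: pos_le_divide_eq)
    then show ?thesis by (simp add: algebra_simps)
  qed
  interpret Z: zone_system I v "\<lambda>k. \<alpha> k + \<delta>" by (rule \<delta>0(2)[OF \<delta>(1,2)])
  have close: "\<bar>Z.pot x - pot x\<bar> \<le> \<eta> / 8" if "norm x = 1" for x
  proof -
    have "\<bar>Z.pot x - pot x\<bar> = \<bar>\<Sum>k\<in>I. zone_potential (\<alpha> k + \<delta>) (v k \<bullet> x) - zone_potential (\<alpha> k) (v k \<bullet> x)\<bar>"
      by (simp add: Z.pot_def pot_def sum_subtractf)
    also have "\<dots> \<le> (\<Sum>k\<in>I. \<bar>zone_potential (\<alpha> k + \<delta>) (v k \<bullet> x) - zone_potential (\<alpha> k) (v k \<bullet> x)\<bar>)"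
      by (rule sum_abs)
    also have "\<dots> \<le> (\<Sum>k\<in>I. \<eta> / (8 * c))"
    proof (rule sum_mono)
      fix k assume k: "k \<in> I"
      show "\<bar>zone_potential (\<alpha> k + \<delta>) (v k \<bullet> x) - zone_potential (\<alpha> k) (v k \<bullet> x)\<bar> \<le> \<eta> / (8 * c)"
        using abs_inner_v_le[OF k that] \<alpha>_pos[OF k] \<alpha>_le[OF k] Z.\<alpha>_le[OF k] \<delta>
        by (intro less_imp_le[OF \<delta>1(2)]) auto
    qed
    also have "\<dots> = \<eta> / 8" using c by (simp add: c_def)
    finally show ?thesis .
  qed
  obtain x where x: "Z.maximal x" using Z.maximal_exists by blast
  then have nx: "norm x = 1" by (simp add: Z.maximal_def)
  obtain i where i: "i \<in> I" "\<bar>v i \<bullet> x\<bar> \<le> sin (\<alpha> i)" using cover[OF nx] by blast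
  have "sin (\<alpha> i) < sin (\<alpha> i + \<delta>)"
    using Z.\<alpha>_le[OF i(1)] \<alpha>_pos[OF i(1)] \<delta> by (intro sin_monotone_2pi) auto
  then have inside: "\<bar>v i \<bullet> x\<bar> < sin (\<alpha> i + \<delta>)" using i by simp
  then have "\<bar>v i \<bullet> x\<bar> < 1" using sin_le_one[of "\<alpha> i + \<delta>"] by linarith
  then obtain e where e: "norm e = 1" "x \<bullet> e = 0" "v i = (v i \<bullet> x) *\<^sub>R x + (v i \<bullet> e) *\<^sub>R e"
    using obtain_orthonormal_partner[OF norm_v[OF i(1)] nx] by blast
  have ny: "norm y = 1" using y by (simp add: maximal_def)
  have p: "norm (circle_point x e u) = 1" for u by (rule norm_circle_point[OF nx e(1,2)])
  have 1: "pot y - pot (circle_point x e u) \<le> Z.pot x - Z.pot (circle_point x e u) + \<eta> / 4" for u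
  proof -
    have "Z.pot y \<le> Z.pot x" using x ny by (simp add: Z.maximal_def)
    then show ?thesis using close[OF ny] close[OF p[of u]] by linarith
  qed
  have ci: "continuous_on {-1..1} (\<lambda>u. Z.pot x - Z.pot (circle_point x e u))"
    by (intro continuous_intros Z.continuous_on_pot_circle_point nx e)
  have "integral {-1..1} (\<lambda>u. pot y - pot (circle_point x e u))
      \<le> integral {-1..1} (\<lambda>u. Z.pot x - Z.pot (circle_point x e u) + \<eta> / 4)"
    by (intro integral_le integrable_continuous_interval continuous_intros
        continuous_on_pot_circle_point Z.continuous_on_pot_circle_point nx e 1)
  also have "\<dots> = integral {-1..1} (\<lambda>u. Z.pot x - Z.pot (circle_point x e u)) + \<eta> / 2"
    using integral_add[OF integrable_continuous_interval[OF ci] integrable_const_ivl[of "\<eta> / 4"]] by simp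
  also have "integral {-1..1} (\<lambda>u. Z.pot x - Z.pot (circle_point x e u)) \<le> pi * ((\<Sum>k\<in>I. 2 * (\<alpha> k + \<delta>)) - pi)"
    using Z.integral_pot_defect_le[OF x e(1,2) i(1) inside e(3), of 1] .
  also have "(\<Sum>k\<in>I. 2 * (\<alpha> k + \<delta>)) - pi = 2 * c * \<delta>"
    using sum_\<alpha> by (simp add: distrib_left sum.distrib c_def)
  finally have "integral {-1..1} (\<lambda>u. pot y - pot (circle_point x e u)) \<le> \<eta>" using \<delta>c by linarith
  then show ?thesis using nx e by blast
qed

text \<open>Compactness: the defect of the arc is continuous in the orthonormal pair, so its infimum
  over all pairs is attained; being at most every positive number, it is nonpositive.\<close>

lemma maximal_arc_exists:
  obtains x e where "norm x = 1" "norm e = 1" "x \<bullet> e = 0"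
    "\<And>u. \<bar>u\<bar> \<le> 1 \<Longrightarrow> maximal (circle_point x e u)"
proof -
  obtain y where y: "maximal y" using maximal_exists by blast
  define K where "K = (sphere 0 1 \<times> sphere 0 1) \<inter> {p :: 'a \<times> 'a. fst p \<bullet> snd p = 0}"
  have cpt: "compact K"
    unfolding K_def by (intro compact_Int_closed compact_Times closed_Collect_eq continuous_intros) auto
  have ne: "K \<noteq> {}"
  proof -
    obtain x e :: 'a where "norm x = 1" "norm e = 1" "x \<bullet> e = 0"
      using approximately_maximal_arc[OF y zero_less_one] by blast
    then have "(x, e) \<in> K" by (simp add: K_def)
    then show ?thesis by blast
  qed
  have cont: "continuous_on K (\<lambda>p. integral (cbox (-1) 1) (\<lambda>u. pot y - pot (circle_point (fst p) (snd p) u)))"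
  proof (rule integral_continuous_on_param)
    have "continuous_on (K \<times> cbox (-1) 1) (\<lambda>z. pot (case z of (p, u) \<Rightarrow> circle_point (fst p) (snd p) u))"
      by (rule continuous_on_compose2[OF continuous_on_pot continuous_on_circle_point_triple])
        (auto simp: K_def norm_circle_point)
    then show "continuous_on (K \<times> cbox (-1) 1) (\<lambda>(p, u). pot y - pot (circle_point (fst p) (snd p) u))"
      unfolding case_prod_unfold by (intro continuous_intros)
  qed
  obtain p where p: "p \<in> K"
      "\<And>q. q \<in> K \<Longrightarrow> integral (cbox (-1) 1) (\<lambda>u. pot y - pot (circle_point (fst p) (snd p) u))
        \<le> integral (cbox (-1) 1) (\<lambda>u. pot y - pot (circle_point (fst q) (snd q) u))"
    using continuous_attains_inf[OF cpt ne cont] by blast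
  let ?J = "integral {-1..1} (\<lambda>u. pot y - pot (circle_point (fst p) (snd p) u))"
  have "?J \<le> \<eta>" if "0 < \<eta>" for \<eta>
  proof -
    obtain x e where "norm x = 1" "norm e = 1" "x \<bullet> e = 0"
      "integral {-1..1} (\<lambda>u. pot y - pot (circle_point x e u)) \<le> \<eta>"
      using approximately_maximal_arc[OF y \<open>0 < \<eta>\<close>] by blast
    then show ?thesis using p(2)[of "(x, e)"] by (simp add: K_def)
  qed
  then have "?J \<le> 0" by (meson dense_ge)
  moreover have "norm (fst p) = 1" "norm (snd p) = 1" "fst p \<bullet> snd p = 0" using p(1) by (auto simp: K_def)
  ultimately show ?thesis
    using maximal_circle_point_if_integral[of "fst p" "snd p" y 1] y that[of "fst p" "snd p"] by auto
qed

text \<open>All but finitely many points of an arc of maxima avoid the zone boundaries. The cover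
  puts such a point strictly inside some zone, and the circle through it and the pole of that zone
  consists of maxima.\<close>

lemma maximal_circle_exists:
  obtains x e where "norm x = 1" "norm e = 1" "x \<bullet> e = 0" "maximal x"
    "\<And>u. maximal (circle_point x e u)"
proof -
  obtain x e where xe: "norm x = 1" "norm e = 1" "x \<bullet> e = 0"
    "\<And>u. \<bar>u\<bar> \<le> 1 \<Longrightarrow> maximal (circle_point x e u)"
    using maximal_arc_exists by blast
  let ?bad = "\<Union>k\<in>I. {u. \<bar>chart (v k \<bullet> x) (v k \<bullet> e) u\<bar> = \<bar>sin (\<alpha> k)\<bar>}"
  have "finite ?bad" using finite_I sin_\<alpha>(1) by (intro finite_UN_I finite_abs_chart_eq) force+
  moreover have "infinite {-1..1::real}" by (simp add: infinite_Icc)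
  ultimately obtain u where u: "u \<in> {-1..1}" "u \<notin> ?bad" by (meson finite_subset subsetI)
  let ?y = "circle_point x e u"
  have y: "maximal ?y" using xe(4) u(1) by auto
  then have ny: "norm ?y = 1" by (simp add: maximal_def)
  obtain i where i: "i \<in> I" "\<bar>v i \<bullet> ?y\<bar> \<le> sin (\<alpha> i)" using cover[OF ny] by blast
  moreover have "\<bar>v i \<bullet> ?y\<bar> \<noteq> sin (\<alpha> i)"
    using u(2) i(1) sin_\<alpha>(1)[OF i(1)] by (auto simp: inner_circle_point)
  ultimately have inside: "\<bar>v i \<bullet> ?y\<bar> < sin (\<alpha> i)" by simp
  then have "\<bar>v i \<bullet> ?y\<bar> < 1" using sin_le_one[of "\<alpha> i"] by linarith
  then obtain f where f: "norm f = 1" "?y \<bullet> f = 0" "v i = (v i \<bullet> ?y) *\<^sub>R ?y + (v i \<bullet> f) *\<^sub>R f"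
    using obtain_orthonormal_partner[OF norm_v[OF i(1)] ny] by blast
  show ?thesis
    by (rule that[OF ny f(1,2) y maximal_circle_point[OF y f(1,2) i(1) inside f(3)]])
qed

lemma pot_minus: "norm x = 1 \<Longrightarrow> pot (- x) = pot x"
  unfolding pot_def using abs_inner_v_le by (intro sum.cong) (auto simp: zone_potential_minus)

lemma maximal_minus: "maximal x \<Longrightarrow> maximal (- x)"
  by (simp add: maximal_def pot_minus)

text \<open>The chart parametrises the open half circle where \<open>sin \<theta>\<close> is
  positive, with parameter the cotangent; the rest follows from maximality of \<open>x\<close> and
  the antipodal symmetry of the potential.\<close>

lemma maximal_great_circle_exists:
  obtains x e where "norm x = 1" "norm e = 1" "x \<bullet> e = 0"
    "\<And>\<theta>. maximal (cos \<theta> *\<^sub>R x + sin \<theta> *\<^sub>R e)"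
proof -
  obtain x e where xe: "norm x = 1" "norm e = 1" "x \<bullet> e = 0" "maximal x"
    "\<And>u. maximal (circle_point x e u)"
    using maximal_circle_exists by blast
  have "maximal (cos \<theta> *\<^sub>R x + sin \<theta> *\<^sub>R e)" for \<theta>
  proof (cases "sin \<theta> = 0")
    case True
    then have "cos \<theta> = 1 \<or> cos \<theta> = -1" using sin_cos_squared_add[of \<theta>] by (simp add: power2_eq_1_iff)
    then show ?thesis using xe(4) maximal_minus[OF xe(4)] True by auto
  next
    case False
    let ?y = "circle_point x e (cos \<theta> / sin \<theta>)"
    have "1 + (cos \<theta> / sin \<theta>)\<^sup>2 = 1 / (sin \<theta>)\<^sup>2"
      using False by (simp add: power_divide field_simps)
    then have "1 / sqrt (1 + (cos \<theta> / sin \<theta>)\<^sup>2) = \<bar>sin \<theta>\<bar>" by (simp add: real_sqrt_divide)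
    then have "?y = \<bar>sin \<theta>\<bar> *\<^sub>R ((cos \<theta> / sin \<theta>) *\<^sub>R x + e)" by (simp add: circle_point_def)
    then have "cos \<theta> *\<^sub>R x + sin \<theta> *\<^sub>R e = ?y \<or> cos \<theta> *\<^sub>R x + sin \<theta> *\<^sub>R e = - ?y"
      using False by (cases "sin \<theta> > 0") (auto simp: scaleR_add_right)
    then show ?thesis using xe(5) maximal_minus by metis
  qed
  then show ?thesis using that xe by blast
qed

end

section \<open>Packing of arcs\<close>

lemma sum_cyclic_shift:
  fixes f :: "nat \<Rightarrow> real"
  shows "(\<Sum>i=1..n. f (if i = n then 1 else i + 1)) = (\<Sum>i=1..n. f i)"
proof (cases "n = 0")
  case False
  have "bij_betw (\<lambda>i. if i = n then 1 else i + 1) {1..n} {1..n}"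
    using False by (intro bij_betw_byWitness[where f' = "\<lambda>i. if i = 1 then n else i - 1"]) auto
  then show ?thesis by (rule sum.reindex_bij_betw)
qed simp

lemma sum_cyclic_gaps:
  fixes g :: "nat \<Rightarrow> real"
  assumes "1 \<le> n"
  shows "(\<Sum>i=1..n. if i = n then g 1 + c - g n else g (i + 1) - g i) = c"
proof -
  have "(\<Sum>i=1..n. if i = n then g 1 + c - g n else g (i + 1) - g i)
     = (\<Sum>i=1..n. g (if i = n then 1 else i + 1) - g i + (if i = n then c else 0))"
    by (intro sum.cong) auto
  also have "\<dots> = c" using assms sum_cyclic_shift[of g n] by (simp add: sum.distrib sum_subtractf)
  finally show ?thesis .
qed

lemma sorting_permutation:
  fixes b :: "nat \<Rightarrow> real"
  assumes "inj_on b {1..n}"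
  obtains \<sigma> where "\<sigma> permutes {1..n}" "strict_mono_on {1..n} (\<lambda>i. b (\<sigma> i))"
proof -
  define xs where "xs = sorted_list_of_set (b ` {1..n})"
  have xs: "sorted_wrt (<) xs" "distinct xs" "set xs = b ` {1..n}" "length xs = n"
    using assms by (auto simp: xs_def card_image simp del: set_sorted_list_of_set
        intro!: set_sorted_list_of_set[THEN trans])
  define h where "h = (!) xs"
  have h: "bij_betw h {..<n} (b ` {1..n})" "strict_mono_on {..<n} h"
    using xs unfolding h_def
    by (auto intro!: bij_betw_nth strict_mono_onI dest: sorted_wrt_nth_less)
  \<comment> \<open>Indices start at 1 but list positions at 0, hence
    \<open>h (i - 1)\<close>.\<close>
  define \<sigma> where "\<sigma> = (\<lambda>i. if i \<in> {1..n} then the_inv_into {1..n} b (h (i - 1)) else i)"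
  have "bij_betw (\<lambda>i. i - 1) {1..n} {..<n}"
    by (rule bij_betw_byWitness[where f' = Suc]) auto
  from bij_betw_trans[OF bij_betw_trans[OF this h(1)] bij_betw_the_inv_into[OF inj_on_imp_bij_betw[OF assms]]]
  have "bij_betw \<sigma> {1..n} {1..n}"
    by (rule bij_betw_cong[THEN iffD1, rotated]) (simp add: \<sigma>_def)
  then have "\<sigma> permutes {1..n}" by (intro bij_imp_permutes) (auto simp: \<sigma>_def)
  moreover have "b (\<sigma> i) = h (i - 1)" if "i \<in> {1..n}" for i
  proof -
    have "h (i - 1) \<in> b ` {1..n}" using that bij_betwE[OF h(1)] by auto
    then show ?thesis using that f_the_inv_into_f[OF assms] by (simp add: \<sigma>_def)
  qed
  then have "strict_mono_on {1..n} (\<lambda>i. b (\<sigma> i))"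
    using strict_mono_onD[OF h(2)] by (intro strict_mono_onI) auto
  ultimately show ?thesis using that by blast
qed

text \<open>After sorting the centres \<open>b\<close> on a circle of length \<open>c\<close>, each
  gap between cyclic neighbours is at least the sum of their half lengths. The gaps add up to
  \<open>c\<close> and the sums to the total length, so equality of the totals forces equality for
  every gap.\<close>

lemma arc_packing:
  fixes b \<beta> :: "nat \<Rightarrow> real"
  assumes n: "1 \<le> n" and pos: "\<And>i. i \<in> {1..n} \<Longrightarrow> 0 < \<beta> i" and le: "\<And>i. i \<in> {1..n} \<Longrightarrow> 2 * \<beta> i \<le> c"
    and sep: "\<And>i j. \<lbrakk>i \<in> {1..n}; j \<in> {1..n}; i \<noteq> j; b i \<le> b j\<rbrakk>
      \<Longrightarrow> \<beta> i + \<beta> j \<le> b j - b i \<and> \<beta> i + \<beta> j \<le> b i + c - b j"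
  shows "(\<Sum>i=1..n. 2 * \<beta> i) \<le> c"
    and "(\<Sum>i=1..n. 2 * \<beta> i) = c \<Longrightarrow> \<exists>\<sigma>. \<sigma> permutes {1..n} \<and> strict_mono_on {1..n} (\<lambda>i. b (\<sigma> i)) \<and>
      (\<forall>i\<in>{1..n}. (if i = n then b (\<sigma> 1) + c - b (\<sigma> n) else b (\<sigma> (i + 1)) - b (\<sigma> i))
         = \<beta> (\<sigma> i) + \<beta> (\<sigma> (if i = n then 1 else i + 1)))"
proof -
  have "inj_on b {1..n}"
  proof (rule inj_onI, rule ccontr)
    fix i j assume "i \<in> {1..n}" "j \<in> {1..n}" "b i = b j" "i \<noteq> j"
    then show False using sep[of i j] pos[of i] pos[of j] by simp
  qed
  then obtain \<sigma> where \<sigma>: "\<sigma> permutes {1..n}" "strict_mono_on {1..n} (\<lambda>i. b (\<sigma> i))"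
    by (rule sorting_permutation)
  let ?gap = "\<lambda>i. if i = n then b (\<sigma> 1) + c - b (\<sigma> n) else b (\<sigma> (i + 1)) - b (\<sigma> i)"
  let ?w = "\<lambda>i. \<beta> (\<sigma> i) + \<beta> (\<sigma> (if i = n then 1 else i + 1))"
  have in_n: "\<sigma> i \<in> {1..n}" if "i \<in> {1..n}" for i using permutes_in_image[OF \<sigma>(1)] that by blast
  have inj: "\<sigma> i = \<sigma> j \<longleftrightarrow> i = j" for i j using permutes_inj[OF \<sigma>(1)] by (simp add: inj_eq)
  have less: "b (\<sigma> i) < b (\<sigma> j)" if "i \<in> {1..n}" "j \<in> {1..n}" "i < j" for i j
    using strict_mono_onD[OF \<sigma>(2)] that by blast
  have w: "?w i \<le> ?gap i" if i: "i \<in> {1..n}" for i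
  proof (cases "i = n")
    case True
    show ?thesis
    \<comment> \<open>A single arc is its own neighbour at gap \<open>c\<close>; here the bound on
      \<open>2 * \<beta> i\<close> takes the place of separation.\<close>
    proof (cases "n = 1")
      case False
      then show ?thesis
        using True i n sep[of "\<sigma> 1" "\<sigma> n"] in_n[of 1] in_n[of n] less[of 1 n] inj[of 1 n] by auto
    qed (use True le in_n[of 1] in auto)
  next
    case False
    then show ?thesis
      using i sep[of "\<sigma> i" "\<sigma> (i + 1)"] in_n[of i] in_n[of "i + 1"] less[of i "i + 1"] inj[of i "i + 1"] by auto
  qed
  have "(\<Sum>i=1..n. ?w i) = (\<Sum>i=1..n. 2 * \<beta> (\<sigma> i))"
    using sum_cyclic_shift[of "\<lambda>i. \<beta> (\<sigma> i)" n] by (simp add: sum.distrib sum_distrib_left[symmetric])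
  also have "\<dots> = (\<Sum>i=1..n. 2 * \<beta> i)"
    using sum.permute[OF \<sigma>(1), of "\<lambda>i. 2 * \<beta> i"] by (simp add: o_def)
  finally have sw: "(\<Sum>i=1..n. ?w i) = (\<Sum>i=1..n. 2 * \<beta> i)" .
  have sg: "(\<Sum>i=1..n. ?gap i) = c" using sum_cyclic_gaps[OF n, of "\<lambda>i. b (\<sigma> i)"] .
  show "(\<Sum>i=1..n. 2 * \<beta> i) \<le> c"
    using sum_mono[of "{1..n}" ?w ?gap, OF w] unfolding sw sg .
  assume eq: "(\<Sum>i=1..n. 2 * \<beta> i) = c"
  have "(\<Sum>i=1..n. ?gap i - ?w i) = 0" unfolding sum_subtractf sw sg eq by simp
  then have "\<forall>i\<in>{1..n}. ?gap i - ?w i = 0"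
    using w by (subst (asm) sum_nonneg_eq_0_iff) (auto simp del: right_minus_eq)
  then show "\<exists>\<sigma>. \<sigma> permutes {1..n} \<and> strict_mono_on {1..n} (\<lambda>i. b (\<sigma> i)) \<and>
      (\<forall>i\<in>{1..n}. (if i = n then b (\<sigma> 1) + c - b (\<sigma> n) else b (\<sigma> (i + 1)) - b (\<sigma> i))
         = \<beta> (\<sigma> i) + \<beta> (\<sigma> (if i = n then 1 else i + 1)))"
    using \<sigma> by (intro exI[of _ \<sigma>]) (simp only: right_minus_eq simp_thms)
qed

lemma abs_sin_less_sin:
  assumes "\<bar>x\<bar> < \<beta>" "\<beta> \<le> pi / 2"
  shows "\<bar>sin x\<bar> < sin \<beta>"
proof -
  have "sin x < sin \<beta>" "sin (- \<beta>) < sin x"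
    using assms by (intro sin_monotone_2pi; simp add: abs_less_iff)+
  then show ?thesis by (simp add: abs_less_iff)
qed

text \<open>A common point divides the segment between the centres in the ratio of the half
  lengths.\<close>

lemma open_arcs_meet:
  fixes b b' \<beta> \<beta>' :: real
  assumes "0 < \<beta>" "\<beta> \<le> pi / 2" "0 < \<beta>'" "\<beta>' \<le> pi / 2" "b \<le> b'" "b' - b < \<beta> + \<beta>'"
  obtains \<theta> where "\<bar>cos (\<theta> - b)\<bar> < sin \<beta>" "\<bar>cos (\<theta> - b')\<bar> < sin \<beta>'"
proof
  define \<theta> where "\<theta> = b + (b' - b) * (\<beta> / (\<beta> + \<beta>'))"
  have "(b' - b) * (\<beta> / (\<beta> + \<beta>')) < (\<beta> + \<beta>') * (\<beta> / (\<beta> + \<beta>'))"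
    using assms by (intro mult_strict_right_mono) auto
  then have 1: "\<bar>\<theta> - b\<bar> < \<beta>" using assms by (simp add: \<theta>_def)
  have "b' - \<theta> = (b' - b) * (1 - \<beta> / (\<beta> + \<beta>'))" by (simp add: \<theta>_def algebra_simps)
  also have "1 - \<beta> / (\<beta> + \<beta>') = \<beta>' / (\<beta> + \<beta>')" using assms by (simp add: field_simps)
  finally have e: "b' - \<theta> = (b' - b) * (\<beta>' / (\<beta> + \<beta>'))" .
  have "(b' - b) * (\<beta>' / (\<beta> + \<beta>')) < (\<beta> + \<beta>') * (\<beta>' / (\<beta> + \<beta>'))"
    using assms by (intro mult_strict_right_mono) auto
  then have "b' - \<theta> < \<beta>'" using e assms by simp
  moreover have "0 \<le> b' - \<theta>" unfolding e using assms by simp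
  ultimately have 2: "\<bar>\<theta> - b'\<bar> < \<beta>'" by linarith
  \<comment> \<open>The arc cut out by a zone is centred a quarter turn away from its pole, so the
    witness is shifted by \<open>pi / 2\<close>.\<close>
  have "cos (\<theta> + pi / 2 - x) = - sin (\<theta> - x)" for x
    using cos_add[of "\<theta> - x" "pi / 2"] by (simp add: algebra_simps)
  then show "\<bar>cos (\<theta> + pi / 2 - b)\<bar> < sin \<beta>" "\<bar>cos (\<theta> + pi / 2 - b')\<bar> < sin \<beta>'"
    using abs_sin_less_sin[OF 1 assms(2)] abs_sin_less_sin[OF 2 assms(4)]
    by simp_all
qed

text \<open>The radius may be negative: a pole matters only up to sign, so its angle is reduced
  modulo \<open>pi\<close>.\<close>

lemma polar_half_turn:
  fixes A B :: real
  obtains c b where "A = c * cos b" "B = c * sin b" "0 \<le> b" "b < pi"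
proof (cases "A = 0 \<and> B = 0")
  case True
  then show ?thesis using that[of 0 0] by simp
next
  case False
  define r where "r = sqrt (A\<^sup>2 + B\<^sup>2)"
  have "A\<^sup>2 + B\<^sup>2 > 0" using False by (simp add: sum_power2_gt_zero_iff)
  then have r: "r > 0" "r\<^sup>2 = A\<^sup>2 + B\<^sup>2" by (auto simp: r_def)
  have "(A / r)\<^sup>2 + (B / r)\<^sup>2 = (A\<^sup>2 + B\<^sup>2) / r\<^sup>2" by (simp only: power_divide add_divide_distrib)
  also have "\<dots> = 1" using r(1) by (simp flip: r(2))
  finally have "(A / r)\<^sup>2 + (B / r)\<^sup>2 = 1" .
  then obtain t where t: "0 \<le> t" "t < 2 * pi" "A / r = cos t" "B / r = sin t" by (rule sincos_total_2pi)
  then have AB: "A = r * cos t" "B = r * sin t" using r by (auto simp: field_simps)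
  show ?thesis
  proof (cases "t < pi")
    case False
    then show ?thesis using that[of "- r" "t - pi"] t AB by simp
  qed (use that t AB in blast)
qed

text \<open>\<open>c k\<close> and \<open>b k\<close> are polar coordinates of the projection of
  \<open>v k\<close> to the plane of a great circle of maxima. If \<bar>c k\<bar> were below 1, zone
  \<open>k\<close> would cut out an arc longer than twice its half width, and packing the lengthened
  arcs would push the sum beyond \<open>pi\<close>.\<close>

lemma tight_cover_planar:
  fixes v :: "nat \<Rightarrow> 'a::euclidean_space"
  assumes "tight_zone_cover {1..n} v \<alpha>"
  obtains x e b where "norm x = 1" "norm e = 1" "x \<bullet> e = 0"
    "\<And>k. k \<in> {1..n} \<Longrightarrow> v k = cos (b k) *\<^sub>R x + sin (b k) *\<^sub>R e \<or> v k = - (cos (b k) *\<^sub>R x + sin (b k) *\<^sub>R e)"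
    "\<And>i j. \<lbrakk>i \<in> {1..n}; j \<in> {1..n}; i \<noteq> j; b i \<le> b j\<rbrakk>
      \<Longrightarrow> \<alpha> i + \<alpha> j \<le> b j - b i \<and> \<alpha> i + \<alpha> j \<le> b i + pi - b j"
proof -
  interpret tight_zone_cover "{1..n}" v \<alpha> by fact
  have n: "1 \<le> n" using nonempty_I by auto
  obtain x e where xe: "norm x = 1" "norm e = 1" "x \<bullet> e = 0" "\<And>\<theta>. maximal (cos \<theta> *\<^sub>R x + sin \<theta> *\<^sub>R e)"
    using maximal_great_circle_exists by blast
  have "\<forall>k. \<exists>c b. v k \<bullet> x = c * cos b \<and> v k \<bullet> e = c * sin b \<and> 0 \<le> b \<and> b < pi"
    using polar_half_turn by metis
  then obtain c b where cb: "\<And>k. v k \<bullet> x = c k * cos (b k)" "\<And>k. v k \<bullet> e = c k * sin (b k)" "\<And>k. 0 \<le> b k" "\<And>k. b k < pi"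
    by metis
  have inner: "v k \<bullet> (cos \<theta> *\<^sub>R x + sin \<theta> *\<^sub>R e) = c k * cos (\<theta> - b k)" for k \<theta>
    by (simp add: inner_add_right cb cos_diff algebra_simps)
  have csq: "(c k)\<^sup>2 = (v k \<bullet> x)\<^sup>2 + (v k \<bullet> e)\<^sup>2" for k
  proof -
    have "(v k \<bullet> x)\<^sup>2 + (v k \<bullet> e)\<^sup>2 = (c k)\<^sup>2 * ((cos (b k))\<^sup>2 + (sin (b k))\<^sup>2)"
      unfolding cb power_mult_distrib by (simp only: distrib_left)
    then show ?thesis by (simp only: sin_cos_squared_add2 mult_1_right)
  qed
  have c1: "\<bar>c k\<bar> \<le> 1" if "k \<in> {1..n}" for k
  proof -
    have "(c k)\<^sup>2 \<le> 1" using bessel_v[OF xe(1-3) that] csq[of k] by linarith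
    then show ?thesis by (simp only: abs_square_le_1)
  qed
  \<comment> \<open>Stated for arbitrary half lengths whose open arcs lie inside the zones, since it
    is used both for the lengthened arcs and for the half widths themselves.\<close>
  have sep: "\<beta> i + \<beta> j \<le> b j - b i \<and> \<beta> i + \<beta> j \<le> b i + pi - b j"
    if ij: "i \<in> {1..n}" "j \<in> {1..n}" "i \<noteq> j" "b i \<le> b j"
      and \<beta>: "\<And>k. k \<in> {1..n} \<Longrightarrow> 0 < \<beta> k \<and> \<beta> k \<le> pi / 2"
        "\<And>k \<theta>. k \<in> {1..n} \<Longrightarrow> \<bar>cos (\<theta> - b k)\<bar> < sin (\<beta> k) \<Longrightarrow> \<bar>c k * cos (\<theta> - b k)\<bar> < sin (\<alpha> k)"
    for i j and \<beta> :: "nat \<Rightarrow> real"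
  proof -
    have no: "\<not> (\<bar>cos (\<theta> - b i)\<bar> < sin (\<beta> i) \<and> \<bar>cos (\<theta> - b j)\<bar> < sin (\<beta> j))" for \<theta>
      using no_overlap[OF xe(4), of i j \<theta>] \<beta>(2)[of i \<theta>] \<beta>(2)[of j \<theta>] ij by (auto simp: inner)
    have "\<not> b j - b i < \<beta> i + \<beta> j"
      using open_arcs_meet[of "\<beta> i" "\<beta> j" "b i" "b j"] \<beta>(1) ij no by metis
    \<comment> \<open>Adding \<open>pi\<close> to \<open>b i\<close> only changes the sign of the
      cosine, so the other side of the cycle reduces to the same argument.\<close>
    moreover have "\<not> b i + pi - b j < \<beta> j + \<beta> i"
    proof
      assume "b i + pi - b j < \<beta> j + \<beta> i"
      moreover have "b j \<le> b i + pi" using cb(3)[of i] cb(4)[of j] by linarith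
      ultimately obtain \<theta> where "\<bar>cos (\<theta> - b j)\<bar> < sin (\<beta> j)" "\<bar>cos (\<theta> - (b i + pi))\<bar> < sin (\<beta> i)"
        using open_arcs_meet[of "\<beta> j" "\<beta> i" "b j" "b i + pi"] \<beta>(1) ij by metis
      moreover have "cos (\<theta> - (b i + pi)) = - cos (\<theta> - b i)" by (simp add: diff_diff_eq[symmetric])
      ultimately show False using no by auto
    qed
    ultimately show ?thesis by linarith
  qed
  have c_eq: "\<bar>c k\<bar> = 1" if k: "k \<in> {1..n}" for k
  proof (rule ccontr)
    assume "\<bar>c k\<bar> \<noteq> 1"
    then have ck: "\<bar>c k\<bar> < 1" using c1[OF k] by simp
    \<comment> \<open>The first bound keeps the arc admissible. By \<open>sin (\<alpha> k +
      \<delta>) \<le> sin (\<alpha> k) + \<delta>\<close>, the second makes the slack from \<bar>c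
      k\<bar> < 1 absorb the lengthening.\<close>
    define \<delta> where "\<delta> = min (pi / 2 - \<alpha> k) (sin (\<alpha> k) * (1 - \<bar>c k\<bar>) / 2)"
    have \<delta>: "0 < \<delta>" "\<delta> \<le> pi / 2 - \<alpha> k" "\<delta> < sin (\<alpha> k) * (1 - \<bar>c k\<bar>)"
      using \<alpha>_less[OF k] sin_\<alpha>(1)[OF k] ck by (auto simp: \<delta>_def min_less_iff_disj)
    define \<beta> where "\<beta> = \<alpha>(k := \<alpha> k + \<delta>)"
    have \<beta>1: "0 < \<beta> j \<and> \<beta> j \<le> pi / 2" if "j \<in> {1..n}" for j
      using \<alpha>_pos[OF that] \<alpha>_le[OF that] \<delta> by (auto simp: \<beta>_def)
    have \<beta>2: "\<bar>c j * cos (\<theta> - b j)\<bar> < sin (\<alpha> j)" if j: "j \<in> {1..n}" and l: "\<bar>cos (\<theta> - b j)\<bar> < sin (\<beta> j)" for j \<theta>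
    proof (cases "j = k")
      case True
      have "sin (\<alpha> k + \<delta>) \<le> sin (\<alpha> k) + \<delta>"
      proof -
        have "sin (\<alpha> k) * cos \<delta> \<le> sin (\<alpha> k) * 1" using sin_\<alpha>(1)[OF k] by (intro mult_left_mono) auto
        moreover have "cos (\<alpha> k) * sin \<delta> \<le> 1 * \<delta>"
          using \<delta>(1,2) \<alpha>_pos[OF k] sin_x_le_x[of \<delta>] sin_ge_zero[of \<delta>] cos_le_one[of "\<alpha> k"]
          by (intro mult_mono) auto
        ultimately show ?thesis by (simp add: sin_add)
      qed
      then have "\<bar>cos (\<theta> - b k)\<bar> \<le> sin (\<alpha> k) + \<delta>" using l True by (simp add: \<beta>_def)
      then have "\<bar>c k\<bar> * \<bar>cos (\<theta> - b k)\<bar> \<le> \<bar>c k\<bar> * (sin (\<alpha> k) + \<delta>)" by (intro mult_left_mono) auto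
      also have "\<dots> \<le> \<bar>c k\<bar> * sin (\<alpha> k) + 1 * \<delta>"
        unfolding distrib_left using ck \<delta>(1) by (intro add_left_mono mult_right_mono) auto
      also have "\<dots> < sin (\<alpha> k)" using \<delta>(3) by (simp add: algebra_simps)
      finally show ?thesis using True by (simp add: abs_mult)
    next
      case False
      have "\<bar>c j\<bar> * \<bar>cos (\<theta> - b j)\<bar> \<le> 1 * \<bar>cos (\<theta> - b j)\<bar>" using c1[OF j] by (intro mult_right_mono) auto
      then show ?thesis using l False by (simp add: abs_mult \<beta>_def)
    qed
    have "(\<Sum>i=1..n. 2 * \<beta> i) \<le> pi"
    proof (rule arc_packing(1)[OF n, where b = b])
      show "0 < \<beta> i" "2 * \<beta> i \<le> pi" if "i \<in> {1..n}" for i using \<beta>1[OF that] by auto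
    qed (rule sep[OF _ _ _ _ \<beta>1 \<beta>2])
    moreover have "(\<Sum>i=1..n. 2 * \<beta> i) = (\<Sum>i=1..n. 2 * \<alpha> i) + (\<Sum>i=1..n. if i = k then 2 * \<delta> else 0)"
      unfolding sum.distrib[symmetric] by (intro sum.cong) (auto simp: \<beta>_def)
    ultimately show False using sum_\<alpha> \<delta>(1) k by simp
  qed
  have "v k = cos (b k) *\<^sub>R x + sin (b k) *\<^sub>R e \<or> v k = - (cos (b k) *\<^sub>R x + sin (b k) *\<^sub>R e)"
    if k: "k \<in> {1..n}" for k
  proof -
    have "(c k)\<^sup>2 = 1" using c_eq[OF k] by (metis one_power2 power2_abs)
    then have "v k = (v k \<bullet> x) *\<^sub>R x + (v k \<bullet> e) *\<^sub>R e"
      using orthonormal_pair_expansion[OF xe(1-3), of "v k"] csq[of k] norm_v[OF k] by simp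
    then have vk: "v k = (c k * cos (b k)) *\<^sub>R x + (c k * sin (b k)) *\<^sub>R e" by (simp only: cb)
    have "c k = 1 \<or> c k = - 1" using c_eq[OF k] by (auto simp: abs_if split: if_splits)
    then show ?thesis using vk by auto
  qed
  moreover have "\<alpha> i + \<alpha> j \<le> b j - b i \<and> \<alpha> i + \<alpha> j \<le> b i + pi - b j"
    if "i \<in> {1..n}" "j \<in> {1..n}" "i \<noteq> j" "b i \<le> b j" for i j
  proof (rule sep[OF that])
    show "0 < \<alpha> k \<and> \<alpha> k \<le> pi / 2" if "k \<in> {1..n}" for k using \<alpha>_pos[OF that] \<alpha>_le[OF that] by simp
    show "\<bar>c k * cos (\<theta> - b k)\<bar> < sin (\<alpha> k)" if "k \<in> {1..n}" "\<bar>cos (\<theta> - b k)\<bar> < sin (\<alpha> k)" for k \<theta>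
      using c_eq[OF that(1)] that(2) by (simp add: abs_mult)
  qed
  ultimately show ?thesis using that xe(1-3) by blast
qed

section \<open>Lines in an oriented plane\<close>

lemma linear_hyperplane_normal:
  fixes H :: "'a::euclidean_space set"
  assumes "linear_hyperplane H"
  obtains v where "norm v = 1" "H = {x. v \<bullet> x = 0}" "orthogonal_comp H = span {v}"
proof -
  obtain u where u: "u \<noteq> 0" "H = {x. u \<bullet> x = 0}" using assms by (auto simp: linear_hyperplane_def)
  define v where "v = (1 / norm u) *\<^sub>R u"
  have v: "norm v = 1" "H = {x. v \<bullet> x = 0}" using u by (auto simp: v_def)
  have "orthogonal_comp H = span {v}"
  proof
    show "orthogonal_comp H \<subseteq> span {v}"
    proof
      fix y assume y: "y \<in> orthogonal_comp H"
      define x where "x = y - (v \<bullet> y) *\<^sub>R v"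
      have "v \<bullet> x = 0" using v(1) by (simp add: x_def inner_diff_right norm_eq_1)
      then have "x \<bullet> y = 0" using y v(2) by (auto simp: orthogonal_comp_def orthogonal_def)
      then have "x \<bullet> x = 0" using \<open>v \<bullet> x = 0\<close> by (simp add: x_def inner_diff_right inner_diff_left inner_commute)
      then have "y = (v \<bullet> y) *\<^sub>R v" by (simp add: x_def)
      then show "y \<in> span {v}" by (metis span_base span_scale singletonI)
    qed
    show "span {v} \<subseteq> orthogonal_comp H"
      using v(2) by (auto simp: span_singleton orthogonal_comp_def orthogonal_def inner_commute)
  qed
  with v that show ?thesis by blast
qed

text \<open>For a unit \<open>y\<close> orthogonal to \<open>v\<close>, Bessel's inequality bounds
  the cosine of its angle to \<open>x\<close> by that of
  \<open>arcsin \<bar>v \<bullet> x\<bar>\<close>. This latitude is therefore a lower bound of all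
  the distances and hence of their infimum.\<close>

lemma zone_imp_abs_inner_le:
  fixes v x :: "'a::euclidean_space"
  assumes "DIM('a) \<ge> 2" "norm v = 1" "\<alpha> < pi / 2" "x \<in> zone (great_sphere {x. v \<bullet> x = 0}) (2 * \<alpha>)"
  shows "norm x = 1 \<and> \<bar>v \<bullet> x\<bar> \<le> sin \<alpha>"
proof -
  let ?C = "great_sphere {x. v \<bullet> x = 0}"
  have x: "norm x = 1" "(INF y\<in>?C. arccos (x \<bullet> y)) \<le> \<alpha>"
    using assms(4) by (auto simp: zone_def spherical_infdist_def spherical_dist_def)
  let ?A = "v \<bullet> x"
  have A: "\<bar>?A\<bar> \<le> 1" using Cauchy_Schwarz_ineq2[of v x] assms(2) x(1) by simp
  \<comment> \<open>Dimension at least 2 makes the great sphere nonempty, so the infimum is a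
    genuine one.\<close>
  obtain w where w: "w \<noteq> 0" "orthogonal v w" using orthogonal_to_vector_exists[OF assms(1), of v] by blast
  then have ne: "?C \<noteq> {}"
  proof -
    have "(1 / norm w) *\<^sub>R w \<in> ?C" using w by (simp add: great_sphere_def orthogonal_def)
    then show ?thesis by blast
  qed
  have "arcsin \<bar>?A\<bar> \<le> (INF y\<in>?C. arccos (x \<bullet> y))"
  proof (rule cINF_greatest[OF ne])
    fix y assume "y \<in> ?C"
    then have y: "norm y = 1" "v \<bullet> y = 0" by (auto simp: great_sphere_def)
    have xy: "\<bar>x \<bullet> y\<bar> \<le> 1" using Cauchy_Schwarz_ineq2[of x y] x(1) y(1) by simp
    have "?A\<^sup>2 + (x \<bullet> y)\<^sup>2 \<le> (norm x)\<^sup>2"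
      unfolding bessel_two[OF assms(2) y, of x] by (simp add: inner_commute)
    then have "?A\<^sup>2 + (x \<bullet> y)\<^sup>2 \<le> 1" using x(1) by simp
    then have "\<bar>x \<bullet> y\<bar> \<le> sqrt (1 - ?A\<^sup>2)" by (intro real_le_rsqrt) simp
    also have "\<dots> = cos (arcsin \<bar>?A\<bar>)" using A by (simp add: cos_arcsin)
    finally have "x \<bullet> y \<le> cos (arcsin \<bar>?A\<bar>)" by linarith
    then have "arccos (cos (arcsin \<bar>?A\<bar>)) \<le> arccos (x \<bullet> y)"
      using xy by (intro arccos_le_arccos) auto
    moreover have "0 \<le> arcsin \<bar>?A\<bar>" using A arcsin_le_arcsin[of 0 "\<bar>?A\<bar>"] by simp
    moreover have "arcsin \<bar>?A\<bar> \<le> pi / 2" using A by (intro arcsin_ubound) auto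
    then have "arcsin \<bar>?A\<bar> \<le> pi" using pi_ge_zero by linarith
    ultimately show "arcsin \<bar>?A\<bar> \<le> arccos (x \<bullet> y)" by (simp add: arccos_cos)
  qed
  then have le: "arcsin \<bar>?A\<bar> \<le> \<alpha>" using x(2) by linarith
  have "sin (arcsin \<bar>?A\<bar>) \<le> sin \<alpha>"
    using le assms(3) arcsin_lbound[of "\<bar>?A\<bar>"] A by (intro sin_monotone_2pi_le) auto
  then show ?thesis using A x(1) by simp
qed

text \<open>The direction reached from \<open>u\<close> by the clockwise rotation through \<open>t\<close> in the frame \<open>(u, v)\<close>.\<close>

definition cw_dir :: "'a::euclidean_space \<Rightarrow> 'a \<Rightarrow> real \<Rightarrow> 'a" where
  "cw_dir u v t = cos t *\<^sub>R u - sin t *\<^sub>R v"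

lemma cw_dir_pi: "span {cw_dir u v (t + pi)} = span {cw_dir u v t}"
proof -
  have "cw_dir u v (t + pi) = - cw_dir u v t" by (simp add: cw_dir_def)
  then show ?thesis using span_image_scale[of "{cw_dir u v t}" "\<lambda>_. - 1"] by simp
qed

context
  fixes V :: "'a::euclidean_space set" and u v :: 'a
  assumes frame: "orthonormal_frame V u v"
begin

lemma frame_inner: "u \<bullet> u = 1" "v \<bullet> v = 1" "u \<bullet> v = 0" "v \<bullet> u = 0"
  using frame by (auto simp: orthonormal_frame_def orthogonal_def norm_eq_1 inner_commute)

lemma clockwise_rotation_cw_dir: "clockwise_rotation u v t (cw_dir u v s) = cw_dir u v (s + t)"
  by (simp add: clockwise_rotation_def cw_dir_def inner_diff_left frame_inner cos_add sin_add algebra_simps)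

lemma clockwise_rotation_span:
  "clockwise_rotation u v t ` span {cw_dir u v s} = span {cw_dir u v (s + t)}"
proof -
  have "linear (clockwise_rotation u v t)"
    unfolding clockwise_rotation_def
    by (intro linearI) (simp_all add: inner_add_left algebra_simps)
  from span_linear_image[OF this, of "{cw_dir u v s}"] show ?thesis
    by (simp add: clockwise_rotation_cw_dir)
qed

lemma span_cw_dir_eqD:
  assumes "span {cw_dir u v s} = span {cw_dir u v t}"
  shows "sin (s - t) = 0"
proof -
  have "cw_dir u v s \<in> span {cw_dir u v t}" using assms span_base by blast
  then obtain k where k: "cw_dir u v s = k *\<^sub>R cw_dir u v t" by (auto simp: span_singleton)
  \<comment> \<open>The test vector is orthogonal to \<open>cw_dir u v t\<close>, and its product
    with \<open>cw_dir u v s\<close> is \<open>- sin (s - t)\<close>.\<close>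
  have "cw_dir u v s \<bullet> (sin t *\<^sub>R u + cos t *\<^sub>R v) = k * (cw_dir u v t \<bullet> (sin t *\<^sub>R u + cos t *\<^sub>R v))"
    unfolding k by simp
  then show ?thesis
    by (simp add: cw_dir_def inner_diff_left inner_add_right frame_inner sin_diff mult.commute)
qed

text \<open>Two admissible angles differ by a zero of the sine of absolute value below
  \<open>pi\<close>, so they agree and the description is unique.\<close>

lemma clockwise_angle_cw_dir:
  assumes "0 < t" "t \<le> pi"
  shows "clockwise_angle u v (span {cw_dir u v s}) (span {cw_dir u v (s + t)}) = t"
  unfolding clockwise_angle_def
proof (rule the_equality)
  fix t' assume t': "0 < t' \<and> t' \<le> pi \<and> clockwise_rotation u v t' ` span {cw_dir u v s} = span {cw_dir u v (s + t)}"
  then have "sin ((s + t') - (s + t)) = 0"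
    unfolding clockwise_rotation_span by (intro span_cw_dir_eqD) auto
  then have "sin (t' - t) = 0" by simp
  moreover have "\<bar>t' - t\<bar> < pi" using t' assms by auto
  ultimately have "t' - t = 0" by (simp only: sin_zero_pi_iff)
  then show "t' = t" by simp
qed (use assms clockwise_rotation_span in auto)

lemma unit_vector_cw_dir:
  assumes "w \<in> V" "norm w = 1"
  obtains s where "w = cw_dir u v s"
proof -
  have "w \<in> span {u, v}" using assms(1) frame by (simp add: orthonormal_frame_def)
  then obtain a b where w: "w = a *\<^sub>R u + b *\<^sub>R v"
    by (auto simp: span_insert span_singleton algebra_simps)
  have "w \<bullet> w = 1" using assms(2) by (simp add: norm_eq_1)
  then have "a\<^sup>2 + (- b)\<^sup>2 = 1"
    by (simp add: w inner_add_left inner_add_right frame_inner power2_eq_square)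
  then obtain s where "a = cos s" "- b = sin s" by (rule sincos_total_2pi)
  then have "a = cos s" "b = - sin s" by auto
  then have "w = cw_dir u v s" by (auto simp: w cw_dir_def minus_equation_iff[of b])
  then show ?thesis by (rule that)
qed

text \<open>The angles are successive differences of the rotation angles \<open>t\<close>, closed up
  by \<open>pi - t n\<close> because a half turn maps a line to itself; they telescope. For
  \<open>n = 1\<close> only the half turn remains.\<close>

lemma sum_clockwise_angles:
  assumes n: "1 \<le> n" and w: "norm w = 1" "span {w} = L 1" "L 1 \<subseteq> V"
    and order: "in_clockwise_order u v n L"
  shows "(\<Sum>i=1..n. clockwise_angle u v (L i) (L (if i = n then 1 else i + 1))) = pi"
proof -
  obtain t where t: "t 1 = 0" "strict_mono_on {1..n} t" "t n < pi"
      "\<And>i. i \<in> {1..n} \<Longrightarrow> L i = clockwise_rotation u v (t i) ` L 1"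
    using order unfolding in_clockwise_order_def by blast
  have "w \<in> V" using w span_base[of w "{w}"] by auto
  then obtain s where s: "w = cw_dir u v s" using unit_vector_cw_dir w(1) by blast
  have L: "L i = span {cw_dir u v (s + t i)}" if "i \<in> {1..n}" for i
    using t(4)[OF that] unfolding w(2)[symmetric] s clockwise_rotation_span .
  have mono: "t i < t j" if "i \<in> {1..n}" "j \<in> {1..n}" "i < j" for i j
    using strict_mono_onD[OF t(2)] that by blast
  have t0: "0 \<le> t i" "t i < pi" if "i \<in> {1..n}" for i
  proof -
    show "0 \<le> t i" using mono[of 1 i] that n t(1) by (cases "i = 1") auto
    show "t i < pi" using mono[of i n] that n t(3) by (cases "i = n") auto
  qed
  have "clockwise_angle u v (L i) (L (if i = n then 1 else i + 1))
      = (if i = n then t 1 + pi - t n else t (i + 1) - t i)" if i: "i \<in> {1..n}" for i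
  proof (cases "i = n")
    case True
    have "L 1 = span {cw_dir u v ((s + t n) + (pi - t n))}"
      using L[of 1] n t(1) cw_dir_pi[of u v s] by simp
    then show ?thesis
      using True L[OF i] clockwise_angle_cw_dir[of "pi - t n" "s + t n"] t0[OF i] t(1) by simp
  next
    case False
    then have i1: "i + 1 \<in> {1..n}" using i by auto
    have "L (i + 1) = span {cw_dir u v ((s + t i) + (t (i + 1) - t i))}" using L[OF i1] by simp
    then show ?thesis
      using False L[OF i] clockwise_angle_cw_dir[of "t (i + 1) - t i" "s + t i"]
        mono[OF i i1] t0[OF i] t0[OF i1] by simp
  qed
  then have "(\<Sum>i=1..n. clockwise_angle u v (L i) (L (if i = n then 1 else i + 1)))
     = (\<Sum>i=1..n. if i = n then t 1 + pi - t n else t (i + 1) - t i)"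
    by (intro sum.cong) auto
  then show ?thesis using sum_cyclic_gaps[OF n] by simp
qed

text \<open>Subtracting \<open>b 1\<close> normalises the first rotation angle to 0; positivity of
  the closing gap keeps the last one below \<open>pi\<close>.\<close>

lemma cw_dir_sequence:
  assumes n: "1 \<le> n" and L: "\<And>i. i \<in> {1..n} \<Longrightarrow> L i = span {cw_dir u v (b i)}"
    and mono: "strict_mono_on {1..n} b"
    and gap: "\<And>i. i \<in> {1..n} \<Longrightarrow> 0 < g i \<and> (if i = n then b 1 + pi - b n else b (i + 1) - b i) = g i"
  shows "in_clockwise_order u v n L"
    and "i \<in> {1..n} \<Longrightarrow> clockwise_angle u v (L i) (L (if i = n then 1 else i + 1)) = g i"
proof -
  have le: "b 1 \<le> b i" "b i \<le> b n" if "i \<in> {1..n}" for i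
  proof -
    show "b 1 \<le> b i" using strict_mono_onD[OF mono, of 1 i] that n by (cases "i = 1") auto
    show "b i \<le> b n" using strict_mono_onD[OF mono, of i n] that n by (cases "i = n") auto
  qed
  have span_lt: "b n - b 1 < pi" using gap[of n] n by auto
  have "L i = clockwise_rotation u v (b i - b 1) ` L 1" if "i \<in> {1..n}" for i
    using L[OF that] L[of 1] n by (simp add: clockwise_rotation_span)
  then have rot: "\<forall>i\<in>{1..n}. L i = clockwise_rotation u v (b i - b 1) ` L 1" by blast
  have "strict_mono_on {1..n} (\<lambda>i. b i - b 1)"
    using strict_mono_onD[OF mono] by (intro strict_mono_onI) auto
  note conj = conjI[OF diff_self[of "b 1"] conjI[OF this conjI[OF span_lt rot]]]
  show "in_clockwise_order u v n L"
    unfolding in_clockwise_order_def by (rule exI[of _ "\<lambda>i. b i - b 1"]) (rule conj)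
  assume i: "i \<in> {1..n}"
  show "clockwise_angle u v (L i) (L (if i = n then 1 else i + 1)) = g i"
  proof (cases "i = n")
    case True
    have g: "g i = b 1 + pi - b n" "0 < g i" using gap[OF i] True by auto
    have "L 1 = span {cw_dir u v (b n + g i)}"
      using L[of 1] n cw_dir_pi[of u v "b 1"] g by simp
    then show ?thesis
      using True L[OF i] clockwise_angle_cw_dir[of "g i" "b n"] g le(1)[of n] n by simp
  next
    case False
    then have i1: "i + 1 \<in> {1..n}" using i by auto
    have g: "g i = b (i + 1) - b i" "0 < g i" using gap[OF i] False by auto
    have "g i \<le> pi" using g le(1)[OF i] le(2)[OF i1] span_lt by linarith
    then show ?thesis
      using False L[OF i] L[OF i1] clockwise_angle_cw_dir[of "g i" "b i"] g by simp
  qed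
qed

end

section \<open>From zones to half widths, lines and angles\<close>

theorem theorem1:
  fixes d n :: nat
    and H P L :: "nat \<Rightarrow> 'a::euclidean_space set"
    and \<alpha> :: "nat \<Rightarrow> real"
  assumes "d \<ge> 1" and "DIM('a) = d + 1" and "n \<ge> 1"
    and "\<And>i. i \<in> {1..n} \<Longrightarrow> linear_hyperplane (H i)"
    and "\<And>i. i \<in> {1..n} \<Longrightarrow> \<alpha> i > 0"
    and "\<And>i. i \<in> {1..n} \<Longrightarrow> P i = zone (great_sphere (H i)) (2 * \<alpha> i)"
    and "sphere 0 1 = (\<Union>i\<in>{1..n}. P i)"
    and "\<And>i. i \<in> {1..n} \<Longrightarrow> L i = orthogonal_comp (H i)"
  shows "(\<Sum>i=1..n. 2 * \<alpha> i) \<ge> pi \<and>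
    ((\<Sum>i=1..n. 2 * \<alpha> i) = pi \<longleftrightarrow>
      (\<exists>\<sigma>. \<sigma> permutes {1..n} \<and>
        (\<exists>V u v. subspace V \<and> dim V = 2 \<and> (\<forall>i\<in>{1..n}. L (\<sigma> i) \<subseteq> V) \<and>
          orthonormal_frame V u v \<and>
          in_clockwise_order u v n (\<lambda>i. L (\<sigma> i)) \<and>
          (\<forall>i\<in>{1..n}. let j = (if i = n then 1 else i + 1) in
             clockwise_angle u v (L (\<sigma> i)) (L (\<sigma> j)) = \<alpha> (\<sigma> i) + \<alpha> (\<sigma> j)))))"
proof -
  note n = assms(3) and pos = assms(5)
  have dim2: "DIM('a) \<ge> 2" using assms(1,2) by simp
  have "\<forall>i\<in>{1..n}. \<exists>v. norm v = 1 \<and> H i = {x. v \<bullet> x = 0} \<and> orthogonal_comp (H i) = span {v}"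
    using linear_hyperplane_normal[OF assms(4)] by metis
  then obtain v where v: "\<And>i. i \<in> {1..n} \<Longrightarrow> norm (v i) = 1" "\<And>i. i \<in> {1..n} \<Longrightarrow> H i = {x. v i \<bullet> x = 0}"
      "\<And>i. i \<in> {1..n} \<Longrightarrow> L i = span {v i}"
    using assms(8) by metis
  have cover: "\<exists>k\<in>{1..n}. \<bar>v k \<bullet> x\<bar> \<le> sin (\<alpha> k)"
    if "\<And>k. k \<in> {1..n} \<Longrightarrow> \<alpha> k < pi / 2" "norm x = 1" for x
  proof -
    have "x \<in> (\<Union>i\<in>{1..n}. P i)" using that(2) unfolding assms(7)[symmetric] by simp
    then obtain k where k: "k \<in> {1..n}" "x \<in> P k" by blast
    then have "x \<in> zone (great_sphere {x. v k \<bullet> x = 0}) (2 * \<alpha> k)" using assms(6) v(2) by simp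
    then show ?thesis using zone_imp_abs_inner_le[OF dim2 v(1)[OF k(1)] that(1)[OF k(1)]] k(1) by blast
  qed
  have le_sum: "2 * \<alpha> i \<le> (\<Sum>i=1..n. 2 * \<alpha> i)" if "i \<in> {1..n}" for i
    using that pos by (intro member_le_sum) (auto intro: less_imp_le)
  have ge: "(\<Sum>i=1..n. 2 * \<alpha> i) \<ge> pi"
  \<comment> \<open>The analytic description of a zone needs half width below \<open>pi / 2\<close>;
    a wider zone attains the bound alone.\<close>
  proof (cases "\<forall>k\<in>{1..n}. \<alpha> k < pi / 2")
    case True
    then show ?thesis using cover by (intro zone_cover_sum_ge_pi[of _ v] v(1) pos) auto
  next
    case False
    then obtain k where "k \<in> {1..n}" "pi / 2 \<le> \<alpha> k" by force
    then show ?thesis using le_sum[of k] by simp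
  qed
  \<comment> \<open>Around the cycle every half width occurs in two neighbouring terms.\<close>
  have cyc: "(\<Sum>i=1..n. \<alpha> (\<sigma> i) + \<alpha> (\<sigma> (if i = n then 1 else i + 1))) = (\<Sum>i=1..n. 2 * \<alpha> i)"
    if "\<sigma> permutes {1..n}" for \<sigma>
  proof -
    have "(\<Sum>i=1..n. \<alpha> (\<sigma> i) + \<alpha> (\<sigma> (if i = n then 1 else i + 1))) = (\<Sum>i=1..n. 2 * \<alpha> (\<sigma> i))"
      using sum_cyclic_shift[of "\<lambda>i. \<alpha> (\<sigma> i)" n] by (simp add: sum.distrib sum_distrib_left[symmetric])
    also have "\<dots> = (\<Sum>i=1..n. 2 * \<alpha> i)"
      using sum.permute[OF that, of "\<lambda>i. 2 * \<alpha> i"] by (simp add: o_def)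
    finally show ?thesis .
  qed
  have coplanar: "\<exists>\<sigma>. \<sigma> permutes {1..n} \<and>
        (\<exists>V u w. subspace V \<and> dim V = 2 \<and> (\<forall>i\<in>{1..n}. L (\<sigma> i) \<subseteq> V) \<and>
          orthonormal_frame V u w \<and>
          in_clockwise_order u w n (\<lambda>i. L (\<sigma> i)) \<and>
          (\<forall>i\<in>{1..n}. clockwise_angle u w (L (\<sigma> i)) (L (\<sigma> (if i = n then 1 else i + 1)))
             = \<alpha> (\<sigma> i) + \<alpha> (\<sigma> (if i = n then 1 else i + 1))))"
    if eq: "(\<Sum>i=1..n. 2 * \<alpha> i) = pi"
  proof -
    obtain x e :: 'a and b where xe: "norm x = 1" "norm e = 1" "x \<bullet> e = 0"
      and Lb: "\<And>k. k \<in> {1..n} \<Longrightarrow> L k = span {cw_dir x e (b k)}"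
      and sep: "\<And>i j. \<lbrakk>i \<in> {1..n}; j \<in> {1..n}; i \<noteq> j; b i \<le> b j\<rbrakk>
        \<Longrightarrow> \<alpha> i + \<alpha> j \<le> b j - b i \<and> \<alpha> i + \<alpha> j \<le> b i + pi - b j"
    \<comment> \<open>For a single zone the half width is \<open>pi / 2\<close>, outside the tight
      cover setting; any unit vector orthogonal to the normal completes a plane, and separation is
      vacuous.\<close>
    proof (cases "n = 1")
      case True
      obtain w where w: "w \<noteq> 0" "orthogonal (v 1) w" using orthogonal_to_vector_exists[OF dim2] by blast
      show ?thesis
        by (rule that[of "v 1" "(1 / norm w) *\<^sub>R w" "\<lambda>_. 0"])
          (use w v True in \<open>auto simp: cw_dir_def orthogonal_def\<close>)
    next
      case False
      \<comment> \<open>Two zones have total at most \<open>pi\<close> and both are positive, so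
        neither reaches width \<open>pi\<close>.\<close>
      have less: "\<alpha> k < pi / 2" if k: "k \<in> {1..n}" for k
      proof -
        obtain j where j: "j \<in> {1..n}" "j \<noteq> k" using False n by (cases "k = 1") (auto intro: that[of 1] that[of 2])
        have "(\<Sum>i\<in>{k, j}. 2 * \<alpha> i) \<le> (\<Sum>i=1..n. 2 * \<alpha> i)"
          using j k pos by (intro sum_mono2) (auto intro: less_imp_le)
        then have "2 * \<alpha> k + 2 * \<alpha> j \<le> pi" using j(2) eq by simp
        then show ?thesis using pos[OF j(1)] by linarith
      qed
      have "tight_zone_cover {1..n} v \<alpha>"
        by unfold_locales (use v(1) pos less cover[OF less] eq in \<open>auto intro: less_imp_le\<close>)
      then obtain x e b where xe: "norm x = 1" "norm e = 1" "x \<bullet> e = 0"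
        and vb: "\<And>k. k \<in> {1..n} \<Longrightarrow> v k = cos (b k) *\<^sub>R x + sin (b k) *\<^sub>R e \<or> v k = - (cos (b k) *\<^sub>R x + sin (b k) *\<^sub>R e)"
        and sep: "\<And>i j. \<lbrakk>i \<in> {1..n}; j \<in> {1..n}; i \<noteq> j; b i \<le> b j\<rbrakk>
          \<Longrightarrow> \<alpha> i + \<alpha> j \<le> b j - b i \<and> \<alpha> i + \<alpha> j \<le> b i + pi - b j"
        using tight_cover_planar by metis
      have neg: "span {- w} = span {w}" for w :: 'a
        using span_image_scale[of "{w}" "\<lambda>_. - 1"] by simp
      \<comment> \<open>Replacing \<open>e\<close> by \<open>- e\<close> reverses the orientation,
        so that increasing \<open>b\<close> becomes clockwise.\<close>
      have "L k = span {cw_dir x (- e) (b k)}" if "k \<in> {1..n}" for k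
      proof -
        have "cw_dir x (- e) (b k) = cos (b k) *\<^sub>R x + sin (b k) *\<^sub>R e" by (simp add: cw_dir_def)
        then show ?thesis using vb[OF that] v(3)[OF that] neg by metis
      qed
      then show ?thesis using that[of x "- e" b] xe sep by simp
    qed
    have half: "2 * \<alpha> i \<le> pi" if "i \<in> {1..n}" for i using le_sum[OF that] eq by simp
    obtain \<sigma> where \<sigma>: "\<sigma> permutes {1..n}" "strict_mono_on {1..n} (\<lambda>i. b (\<sigma> i))"
      "\<And>i. i \<in> {1..n} \<Longrightarrow> (if i = n then b (\<sigma> 1) + pi - b (\<sigma> n) else b (\<sigma> (i + 1)) - b (\<sigma> i))
         = \<alpha> (\<sigma> i) + \<alpha> (\<sigma> (if i = n then 1 else i + 1))"
      using arc_packing(2)[OF n pos half sep eq] by blast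
    have in_n: "\<sigma> i \<in> {1..n}" if "i \<in> {1..n}" for i using permutes_in_image[OF \<sigma>(1)] that by blast
    define V where "V = span {x, e}"
    have frame: "orthonormal_frame V x e"
      using xe by (simp add: orthonormal_frame_def orthogonal_def V_def)
    have "x \<noteq> e" using xe by (auto simp: norm_eq_1)
    have "pairwise orthogonal {x, e}" using xe(3) by (auto simp: pairwise_def orthogonal_def inner_commute)
    then have "independent {x, e}" using xe by (intro pairwise_orthogonal_independent) auto
    then have "dim V = 2" using \<open>x \<noteq> e\<close> by (simp add: V_def dim_eq_card_independent)
    moreover have "L (\<sigma> i) \<subseteq> V" if "i \<in> {1..n}" for i
      unfolding Lb[OF in_n[OF that]] V_def
      by (intro span_minimal) (simp_all add: cw_dir_def span_diff span_scale span_base)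
    moreover have pos': "0 < \<alpha> (\<sigma> i) + \<alpha> (\<sigma> (if i = n then 1 else i + 1))" if "i \<in> {1..n}" for i
      using that n by (intro add_pos_pos pos in_n) auto
    note seq = cw_dir_sequence[OF frame n Lb[OF in_n] \<sigma>(2),
        where g = "\<lambda>i. \<alpha> (\<sigma> i) + \<alpha> (\<sigma> (if i = n then 1 else i + 1))", OF _ conjI[OF pos' \<sigma>(3)]]
    have "in_clockwise_order x e n (\<lambda>i. L (\<sigma> i))" by (rule seq(1))
    moreover have "clockwise_angle x e (L (\<sigma> i)) (L (\<sigma> (if i = n then 1 else i + 1)))
        = \<alpha> (\<sigma> i) + \<alpha> (\<sigma> (if i = n then 1 else i + 1))" if "i \<in> {1..n}" for i
      using that by (rule seq(2)[rotated -1])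
    moreover have "subspace V" by (simp add: V_def)
    ultimately show ?thesis using \<sigma>(1) frame by blast
  qed
  \<comment> \<open>Converse direction: the cyclic angles sum to \<open>pi\<close>, and the
    prescribed values sum to the total width.\<close>
  have sum_eq: "(\<Sum>i=1..n. 2 * \<alpha> i) = pi"
    if \<sigma>: "\<sigma> permutes {1..n}" and V: "\<And>i. i \<in> {1..n} \<Longrightarrow> L (\<sigma> i) \<subseteq> V" "orthonormal_frame V u w"
      "in_clockwise_order u w n (\<lambda>i. L (\<sigma> i))"
      and angle: "\<And>i. i \<in> {1..n} \<Longrightarrow> clockwise_angle u w (L (\<sigma> i)) (L (\<sigma> (if i = n then 1 else i + 1)))
        = \<alpha> (\<sigma> i) + \<alpha> (\<sigma> (if i = n then 1 else i + 1))" for \<sigma> V u w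
  proof -
    have 1: "1 \<in> {1..n}" using n by simp
    then have s1: "\<sigma> 1 \<in> {1..n}" using permutes_in_image[OF \<sigma>] by blast
    have "(\<Sum>i=1..n. clockwise_angle u w (L (\<sigma> i)) (L (\<sigma> (if i = n then 1 else i + 1)))) = pi"
      by (rule sum_clockwise_angles[OF V(2) n v(1)[OF s1], where L = "\<lambda>i. L (\<sigma> i)"])
        (rule v(3)[OF s1, symmetric] V(1)[OF 1] V(3))+
    moreover have "(\<Sum>i=1..n. clockwise_angle u w (L (\<sigma> i)) (L (\<sigma> (if i = n then 1 else i + 1))))
        = (\<Sum>i=1..n. \<alpha> (\<sigma> i) + \<alpha> (\<sigma> (if i = n then 1 else i + 1)))"
      by (rule sum.cong[OF refl angle])
    ultimately show ?thesis using cyc[OF \<sigma>] by linarith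
  qed
  show ?thesis
    unfolding Let_def
  proof (intro conjI iffI ge)
    assume "(\<Sum>i=1..n. 2 * \<alpha> i) = pi"
    then show "\<exists>\<sigma>. \<sigma> permutes {1..n} \<and>
        (\<exists>V u w. subspace V \<and> dim V = 2 \<and> (\<forall>i\<in>{1..n}. L (\<sigma> i) \<subseteq> V) \<and>
          orthonormal_frame V u w \<and>
          in_clockwise_order u w n (\<lambda>i. L (\<sigma> i)) \<and>
          (\<forall>i\<in>{1..n}. clockwise_angle u w (L (\<sigma> i)) (L (\<sigma> (if i = n then 1 else i + 1)))
             = \<alpha> (\<sigma> i) + \<alpha> (\<sigma> (if i = n then 1 else i + 1))))"
      by (rule coplanar)
  qed (elim exE conjE, rule sum_eq, assumption, erule (1) bspec, assumption, assumption, erule (1) bspec)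
qed

end
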